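(* Let $Z_L$ be a Quantum Torus. Then the endomorphism ring of $Z_L$ (in the category $\mathcal{QT}$) is isomorphic to either $\mathbb{Z}$ or an order of a real quadratic field.
   Context: Fix a nonstandard model ${}^*:V(\mathbb{R})\to V({}^*\mathbb{R})$ of the superstructure over $\mathbb{R}$ (with transfer and saturation); internal sets are elements of ${}^*B$ for $B\in V(\mathbb{R})$. ${}^*\mathbb{R}^{\mathrm{nst}}$ is the set of near-standard elements of ${}^*\mathbb{R}$ and $\mathrm{st}$ the standard part map. A pseudolattice is a dense additive subgroup $L\subseteq\mathbb{R}$ of rank two. The Quantum Torus of $L$ is $Z_L=\mathbb{R}/L$; the Hyper Quantum Torus is $T_L={}^*\mathbb{R}^{\mathrm{nst}}/L$ with projection $\pi_L$, and $p_L:T_L\to Z_L$, $\pi_L(x)\mapsto\mathrm{st}(x)+L$. A morphism $T_L\to T_M$ of Hyper Quantum Tori is the map $x+L\mapsto\phi(x)+M$ induced by an internal additive homomorphism $\phi:{}^*\mathbb{R}\to{}^*\mathbb{R}$ mapping ${}^*\mathbb{R}^{\mathrm{nst}}$ into itself with $\phi(r)+M=\phi(r+L)$ for all $r\in{}^*\mathbb{R}^{\mathrm{nst}}$. In the category $\mathcal{QT}$ of Quantum Tori, a morphism $Z_L\to Z_M$ is a map $f$ such that some morphism $\tilde f:T_L\to T_M$ of Hyper Quantum Tori satisfies $p_M\circ\tilde f=f\circ p_L$. The endomorphism ring of $Z_L$ is the set of such morphisms $Z_L\to Z_L$ with pointwise addition and composition.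
   Formalization: The condition φ(r)+M = φ(r+L) on morphisms is taken as φ(r+L) ⊆ φ(r)+M (the induced map is well defined); literal equality of sets would force φ(L)=M, exclude the zero map, and the endomorphisms would not form a ring. *)

theory Defs
  imports "HOL-Analysis.Elementary_Topology" "HOL-Algebra.IntRing" "HOL-Algebra.Embedded_Algebras"
begin

section \<open>Superstructures\<close>

text \<open>
  The superstructure over \<open>X\<close> is the union of \<open>V\<^sub>0 = X\<close> and \<open>V\<^sub>n\<^sub>+\<^sub>1 = V\<^sub>n \<union> Pow V\<^sub>n\<close>. It contains iterated
  power sets of every finite order, so it is not available as a concrete type over a given type. It is
  therefore described, uniquely up to isomorphism, as a type with a membership relation and a
  set of atoms (individuals).
\<close>

record 'u universe =
  memb :: "'u \<Rightarrow> 'u \<Rightarrow> bool"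
  atoms :: "'u set"

primrec level :: "'u universe \<Rightarrow> nat \<Rightarrow> 'u set" where
  "level U 0 = atoms U"
| "level U (Suc n) = level U n \<union> {x. x \<notin> atoms U \<and> (\<forall>z. memb U z x \<longrightarrow> z \<in> level U n)}"

definition superstructure :: "'u universe \<Rightarrow> bool" where
  "superstructure U \<longleftrightarrow>
     (\<forall>a\<in>atoms U. \<forall>z. \<not> memb U z a) \<and>
     (\<forall>x y. x \<notin> atoms U \<and> y \<notin> atoms U \<and> (\<forall>z. memb U z x \<longleftrightarrow> memb U z y) \<longrightarrow> x = y) \<and>
     (\<forall>n S. S \<subseteq> level U n \<longrightarrow> (\<exists>x. x \<notin> atoms U \<and> (\<forall>z. memb U z x \<longleftrightarrow> z \<in> S))) \<and>
     (\<forall>x. \<exists>n. x \<in> level U n)"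

text \<open>The object of the superstructure that represents \<open>S\<close>; meaningful if \<open>S \<subseteq> level U n\<close> for some \<open>n\<close>.\<close>

definition mkset :: "'u universe \<Rightarrow> 'u set \<Rightarrow> 'u" where
  "mkset U S = (THE x. x \<notin> atoms U \<and> (\<forall>z. memb U z x \<longleftrightarrow> z \<in> S))"

definition opair :: "'u universe \<Rightarrow> 'u \<Rightarrow> 'u \<Rightarrow> 'u" where
  "opair U x y = mkset U {mkset U {x}, mkset U {x, y}}"

section \<open>Nonstandard models\<close>

text \<open>
  Bounded formulas of the language of set theory. \<open>BAll i j p\<close> stands for \<open>\<forall>x\<^sub>i\<in>x\<^sub>j. p\<close>. Parameters
  are supplied by the assignment.
\<close>

datatype bform = Mem nat nat | Eq nat nat | Neg bform | Conj bform bform | BAll nat nat bform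

primrec sat :: "'u universe \<Rightarrow> (nat \<Rightarrow> 'u) \<Rightarrow> bform \<Rightarrow> bool" where
  "sat U e (Mem i j) \<longleftrightarrow> memb U (e i) (e j)"
| "sat U e (Eq i j) \<longleftrightarrow> e i = e j"
| "sat U e (Neg p) \<longleftrightarrow> \<not> sat U e p"
| "sat U e (Conj p q) \<longleftrightarrow> sat U e p \<and> sat U e q"
| "sat U e (BAll i j p) \<longleftrightarrow> (\<forall>u. memb U u (e j) \<longrightarrow> sat U (e(i := u)) p)"

record ('v, 'w) nsmodel =
  std :: "'v universe"
  nonstd :: "'w universe"
  emb :: "real \<Rightarrow> 'v"
  star :: "'v \<Rightarrow> 'w"

definition internal :: "('v, 'w) nsmodel \<Rightarrow> 'w \<Rightarrow> bool" where
  "internal N x \<longleftrightarrow> (\<exists>B. memb (nonstd N) x (star N B))"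

definition transfer :: "('v, 'w) nsmodel \<Rightarrow> bool" where
  "transfer N \<longleftrightarrow> (\<forall>p e. sat (std N) e p \<longleftrightarrow> sat (nonstd N) (star N \<circ> e) p)"

text \<open>Countable saturation, which is implied by saturation for any larger cardinal.\<close>

definition saturated :: "('v, 'w) nsmodel \<Rightarrow> bool" where
  "saturated N \<longleftrightarrow>
     (\<forall>F :: nat \<Rightarrow> 'w.
        (\<forall>n. internal N (F n)) \<and>
        (\<forall>I. finite I \<longrightarrow> (\<exists>z. \<forall>n\<in>I. memb (nonstd N) z (F n))) \<longrightarrow>
        (\<exists>z. \<forall>n. memb (nonstd N) z (F n)))"

text \<open>
  The atoms of the first universe are the reals; those of the second one are the elements of the star
  of the set of reals, that is, the hyperreals.
\<close>

definition nonstandard_model :: "('v, 'w) nsmodel \<Rightarrow> bool" where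
  "nonstandard_model N \<longleftrightarrow>
     superstructure (std N) \<and> inj (emb N) \<and> atoms (std N) = range (emb N) \<and>
     superstructure (nonstd N) \<and>
     atoms (nonstd N) = {x. memb (nonstd N) x (star N (mkset (std N) (range (emb N))))} \<and>
     transfer N \<and> saturated N"

section \<open>Hyperreals\<close>

abbreviation hyperreals :: "('v, 'w) nsmodel \<Rightarrow> 'w set" where
  "hyperreals N \<equiv> atoms (nonstd N)"

definition hreal :: "('v, 'w) nsmodel \<Rightarrow> real \<Rightarrow> 'w" where
  "hreal N r = star N (emb N r)"

definition star_fun2 :: "('v, 'w) nsmodel \<Rightarrow> (real \<Rightarrow> real \<Rightarrow> real) \<Rightarrow> 'w \<Rightarrow> 'w \<Rightarrow> 'w" where
  "star_fun2 N f x y =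
     (THE z. memb (nonstd N) (opair (nonstd N) (opair (nonstd N) x y) z)
        (star N (mkset (std N)
          {opair (std N) (opair (std N) (emb N a) (emb N b)) (emb N (f a b)) | a b. True})))"

definition hless :: "('v, 'w) nsmodel \<Rightarrow> 'w \<Rightarrow> 'w \<Rightarrow> bool" where
  "hless N x y \<longleftrightarrow>
     memb (nonstd N) (opair (nonstd N) x y)
       (star N (mkset (std N) {opair (std N) (emb N a) (emb N b) | a b. a < b}))"

definition infinitely_close :: "('v, 'w) nsmodel \<Rightarrow> 'w \<Rightarrow> 'w \<Rightarrow> bool" where
  "infinitely_close N x y \<longleftrightarrow>
     (\<forall>\<epsilon>::real. \<epsilon> > 0 \<longrightarrow> hless N (star_fun2 N (\<lambda>a b. \<bar>a - b\<bar>) x y) (hreal N \<epsilon>))"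

definition nst :: "('v, 'w) nsmodel \<Rightarrow> 'w set" where
  "nst N = {x \<in> hyperreals N. \<exists>r. infinitely_close N x (hreal N r)}"

definition st :: "('v, 'w) nsmodel \<Rightarrow> 'w \<Rightarrow> real" where
  "st N x = (THE r. infinitely_close N x (hreal N r))"

definition hyper_group :: "('v, 'w) nsmodel \<Rightarrow> 'w monoid" where
  "hyper_group N = \<lparr>carrier = hyperreals N, mult = star_fun2 N (+), one = hreal N 0\<rparr>"

definition nst_group :: "('v, 'w) nsmodel \<Rightarrow> 'w monoid" where
  "nst_group N = (hyper_group N)\<lparr>carrier := nst N\<rparr>"

section \<open>Quantum Tori\<close>

definition real_ring :: "real ring" where
  "real_ring = \<lparr>carrier = UNIV, mult = (*), one = 1, zero = 0, add = (+)\<rparr>"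

abbreviation real_group :: "real monoid" where
  "real_group \<equiv> add_monoid real_ring"

text \<open>Rank two means free of rank two, i.e. isomorphic to \<open>\<int>\<^sup>2\<close>.\<close>

definition pseudolattice :: "real set \<Rightarrow> bool" where
  "pseudolattice L \<longleftrightarrow>
     subgroup L real_group \<and> closure L = UNIV \<and>
     (\<exists>a b. L = {of_int m * a + of_int n * b | m n. True} \<and>
            (\<forall>m n. of_int m * a + of_int n * b = 0 \<longrightarrow> m = 0 \<and> n = 0))"

definition quantum_torus :: "real set \<Rightarrow> real set monoid" where
  "quantum_torus L = real_group Mod L"

definition hyper_torus :: "('v, 'w) nsmodel \<Rightarrow> real set \<Rightarrow> 'w set monoid" where
  "hyper_torus N L = nst_group N Mod (hreal N ` L)"

definition hproj :: "('v, 'w) nsmodel \<Rightarrow> real set \<Rightarrow> 'w \<Rightarrow> 'w set" where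
  "hproj N L x = (hreal N ` L) #>\<^bsub>nst_group N\<^esub> x"

text \<open>All cosets in this union coincide.\<close>

definition torus_st :: "('v, 'w) nsmodel \<Rightarrow> real set \<Rightarrow> 'w set \<Rightarrow> real set" where
  "torus_st N L X = (\<Union>x\<in>X. L #>\<^bsub>real_group\<^esub> st N x)"

text \<open>
  The last condition says that \<open>\<phi>\<close> sends each coset \<open>r + L\<close> into the single coset \<open>\<phi> r + M\<close>, so that the
  induced map on the Hyper Quantum Tori is well defined. The set \<open>\<phi> ` (r + L)\<close> need not exhaust \<open>\<phi> r + M\<close>.
\<close>

definition hyper_hom :: "('v, 'w) nsmodel \<Rightarrow> real set \<Rightarrow> real set \<Rightarrow> ('w \<Rightarrow> 'w) \<Rightarrow> bool" where
  "hyper_hom N L M \<phi> \<longleftrightarrow>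
     \<phi> \<in> hom (hyper_group N) (hyper_group N) \<and>
     internal N (mkset (nonstd N) {opair (nonstd N) x (\<phi> x) | x. x \<in> hyperreals N}) \<and>
     \<phi> ` nst N \<subseteq> nst N \<and>
     (\<forall>r\<in>nst N. \<forall>s\<in>hproj N L r. hproj N M (\<phi> s) = hproj N M (\<phi> r))"

definition hyper_torus_mor :: "('v, 'w) nsmodel \<Rightarrow> real set \<Rightarrow> real set \<Rightarrow> ('w set \<Rightarrow> 'w set) set" where
  "hyper_torus_mor N L M =
     {F \<in> carrier (hyper_torus N L) \<rightarrow>\<^sub>E carrier (hyper_torus N M).
        \<exists>\<phi>. hyper_hom N L M \<phi> \<and> (\<forall>x\<in>nst N. F (hproj N L x) = hproj N M (\<phi> x))}"

definition quantum_torus_mor :: "('v, 'w) nsmodel \<Rightarrow> real set \<Rightarrow> real set \<Rightarrow> (real set \<Rightarrow> real set) set" where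
  "quantum_torus_mor N L M =
     {f \<in> carrier (quantum_torus L) \<rightarrow>\<^sub>E carrier (quantum_torus M).
        \<exists>F \<in> hyper_torus_mor N L M.
          \<forall>X\<in>carrier (hyper_torus N L). torus_st N M (F X) = f (torus_st N L X)}"

definition quantum_torus_End :: "('v, 'w) nsmodel \<Rightarrow> real set \<Rightarrow> (real set \<Rightarrow> real set) ring" where
  "quantum_torus_End N L =
     \<lparr>carrier = quantum_torus_mor N L L,
      mult = compose (carrier (quantum_torus L)),
      one = (\<lambda>X\<in>carrier (quantum_torus L). X),
      zero = (\<lambda>X\<in>carrier (quantum_torus L). \<one>\<^bsub>quantum_torus L\<^esub>),
      add = (\<lambda>f g. \<lambda>X\<in>carrier (quantum_torus L). f X \<otimes>\<^bsub>quantum_torus L\<^esub> g X)\<rparr>"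

section \<open>Orders of real quadratic fields\<close>

text \<open>Up to isomorphism, real quadratic fields are the subfields of the reals of degree two over the rationals.\<close>

definition real_quadratic_field :: "real set \<Rightarrow> bool" where
  "real_quadratic_field K \<longleftrightarrow> subfield K real_ring \<and> ring.dimension real_ring 2 \<rat> K"

text \<open>
  A subring of \<open>K\<close> that is finitely generated as an abelian group and spans \<open>K\<close> over the rationals
  (every element of \<open>K\<close> has a positive integer multiple in it).
\<close>

definition order_of_field :: "real set \<Rightarrow> real set \<Rightarrow> bool" where
  "order_of_field K A \<longleftrightarrow>
     subring A real_ring \<and> A \<subseteq> K \<and>
     (\<exists>B. finite B \<and> A = generate real_group B) \<and>
     (\<forall>x\<in>K. \<exists>n::nat. n > 0 \<and> of_nat n * x \<in> A)"

end

theory Submission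
  imports Defs
begin

text \<open>
  A hyper homomorphism \<open>\<phi>\<close> induces the additive map \<open>r \<mapsto> st (\<phi> r)\<close> on the reals.  As the graph of \<open>\<phi>\<close> is
  internal and \<open>\<phi>\<close> maps near-standard points to near-standard points, saturation forces this map to be
  bounded near \<open>0\<close>, hence it is multiplication by a real number \<open>\<alpha>\<close>, and well-definedness on the torus
  means \<open>\<alpha> L \<subseteq> L\<close>.  Conversely every such \<open>\<alpha>\<close> arises from \<open>x \<mapsto> \<alpha> x\<close>.  So the endomorphism ring is the
  multiplier ring \<open>E = {\<alpha>. \<alpha> L \<subseteq> L}\<close>.  Scaling \<open>L\<close> to \<open>\<int> + \<int> \<theta>\<close> shows \<open>\<int> \<subseteq> E \<subseteq> \<int> + \<int> \<theta>\<close>, so either \<open>E = \<int>\<close> or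
  \<open>E = \<int> + \<int> \<alpha>\<close> for an irrational \<open>\<alpha>\<close>, which is quadratic because \<open>\<alpha>\<^sup>2 \<in> E\<close>.
\<close>

section \<open>Superstructures and transfer\<close>

lemma level_mono: "m \<le> n \<Longrightarrow> level U m \<subseteq> level U n"
  by (induction n) (auto simp: le_Suc_eq)

lemma memb_mkset:
  assumes "superstructure U" "S \<subseteq> level U n"
  shows "memb U z (mkset U S) \<longleftrightarrow> z \<in> S" and "mkset U S \<notin> atoms U"
proof -
  obtain x where x: "x \<notin> atoms U" "\<forall>z. memb U z x \<longleftrightarrow> z \<in> S"
    using assms unfolding superstructure_def by metis
  have "\<exists>!x. x \<notin> atoms U \<and> (\<forall>z. memb U z x \<longleftrightarrow> z \<in> S)"
  proof (rule ex1I[of _ x])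
    show "y = x" if "y \<notin> atoms U \<and> (\<forall>z. memb U z y \<longleftrightarrow> z \<in> S)" for y
      using that x assms(1) unfolding superstructure_def by metis
  qed (use x in auto)
  from theI'[OF this] show "memb U z (mkset U S) \<longleftrightarrow> z \<in> S" "mkset U S \<notin> atoms U"
    unfolding mkset_def by auto
qed

lemma memb_not_atom: "superstructure U \<Longrightarrow> memb U z x \<Longrightarrow> x \<notin> atoms U"
  unfolding superstructure_def by metis

lemma memb_ext:
  "superstructure U \<Longrightarrow> x \<notin> atoms U \<Longrightarrow> y \<notin> atoms U \<Longrightarrow> (\<And>z. memb U z x \<longleftrightarrow> memb U z y) \<Longrightarrow> x = y"
  unfolding superstructure_def by metis

lemma common_level:
  assumes "superstructure U"
  obtains n where "x \<in> level U n" "y \<in> level U n"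
proof -
  obtain i j where "x \<in> level U i" "y \<in> level U j"
    using assms unfolding superstructure_def by metis
  then have "x \<in> level U (max i j)" "y \<in> level U (max i j)"
    using level_mono[of i "max i j" U] level_mono[of j "max i j" U] by auto
  then show ?thesis by (rule that)
qed

lemma memb_mkset_pair:
  assumes "superstructure U"
  shows "memb U z (mkset U {x, y}) \<longleftrightarrow> z = x \<or> z = y"
proof -
  obtain n where "{x, y} \<subseteq> level U n" using common_level[OF assms, of x y] by auto
  from memb_mkset(1)[OF assms this] show ?thesis by simp
qed

lemma memb_opair:
  "superstructure U \<Longrightarrow> memb U z (opair U x y) \<longleftrightarrow> z = mkset U {x} \<or> z = mkset U {x, y}"
  by (simp add: opair_def memb_mkset_pair)

lemma eq_mkset_pair_iff:
  assumes "superstructure U"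
  shows "a = mkset U {x, y} \<longleftrightarrow>
    memb U x a \<and> memb U y a \<and> (\<forall>z. memb U z a \<longrightarrow> z = x \<or> z = y)" (is "_ \<longleftrightarrow> ?R")
proof
  assume R: ?R
  obtain n where "{x, y} \<subseteq> level U n" using common_level[OF assms, of x y] by auto
  from memb_mkset(2)[OF assms this] show "a = mkset U {x, y}"
    using R memb_not_atom[OF assms, of x a]
    by (intro memb_ext[OF assms]) (auto simp: memb_mkset_pair[OF assms])
qed (simp add: memb_mkset_pair[OF assms])

text \<open>All quantifiers on the right range over members of \<open>p\<close> or over members of
  those, so being a given ordered pair is expressible by a bounded formula. \<open>Is_pair\<close>
  copies this shape.\<close>

lemma eq_opair_iff:
  assumes "superstructure U"
  shows "p = opair U x y \<longleftrightarrow>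
    (\<exists>a. memb U a p \<and> (\<exists>b. memb U b p \<and> (\<forall>c. memb U c p \<longrightarrow> c = a \<or> c = b) \<and>
      (memb U x a \<and> (\<forall>z. memb U z a \<longrightarrow> z = x)) \<and>
      (memb U x b \<and> memb U y b \<and> (\<forall>z. memb U z b \<longrightarrow> z = x \<or> z = y))))"
proof -
  have *: "memb U x a \<and> (\<forall>z. memb U z a \<longrightarrow> z = x) \<longleftrightarrow> a = mkset U {x}" for a
    using eq_mkset_pair_iff[OF assms, of a x x] by simp
  show ?thesis
    unfolding * eq_mkset_pair_iff[OF assms, symmetric]
    unfolding opair_def eq_mkset_pair_iff[OF assms, of p] by blast
qed

lemma opair_inject:
  assumes "superstructure U"
  shows "opair U x y = opair U x' y' \<longleftrightarrow> x = x' \<and> y = y'"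
proof
  assume eq: "opair U x y = opair U x' y'"
  have *: "z = mkset U {x} \<or> z = mkset U {x, y} \<longleftrightarrow> z = mkset U {x'} \<or> z = mkset U {x', y'}" for z
    using memb_opair[OF assms] eq by metis
  have m: "memb U z (mkset U {x}) \<longleftrightarrow> z = x" "memb U z (mkset U {x'}) \<longleftrightarrow> z = x'" for z
    using memb_mkset_pair[OF assms, of z x x] memb_mkset_pair[OF assms, of z x' x'] by auto
  have x: "x = x'"
    using *[of "mkset U {x}"] m memb_mkset_pair[OF assms, of x' x' y'] by auto
  have "y = x \<or> y = y'" if "mkset U {x, y} = mkset U {x', y'}"
    using memb_mkset_pair[OF assms, of y x y] memb_mkset_pair[OF assms, of y x' y'] that x by auto
  moreover have "y' = x \<or> y = y'" if "mkset U {x, y} = mkset U {x', y'}"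
    using memb_mkset_pair[OF assms, of y' x y] memb_mkset_pair[OF assms, of y' x' y'] that x by auto
  moreover have "y = x" if "mkset U {x, y} = mkset U {x'}"
    using memb_mkset_pair[OF assms, of y x y] m that x by auto
  moreover have "y' = x" if "mkset U {x', y'} = mkset U {x}"
    using memb_mkset_pair[OF assms, of y' x' y'] m that x by auto
  ultimately have "y = y'"
    using *[of "mkset U {x, y}"] *[of "mkset U {x', y'}"] x by metis
  with x show "x = x' \<and> y = y'" by simp
qed auto

text \<open>Each of the two nested \<open>mkset\<close> steps raises the level by one. This keeps
  the members of relations and graphs within a fixed level, so that \<open>mkset\<close> represents
  these sets.\<close>

lemma level_opair:
  assumes "superstructure U" "x \<in> level U n" "y \<in> level U n"
  shows "opair U x y \<in> level U (Suc (Suc n))"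
proof -
  have s: "mkset U {u, v} \<in> level U (Suc n)" if "u \<in> level U n" "v \<in> level U n" for u v n
  proof -
    have "{u, v} \<subseteq> level U n" using that by auto
    from memb_mkset[OF assms(1) this] show ?thesis using that by auto
  qed
  show ?thesis unfolding opair_def using s[OF s s, OF assms(2,2,2,3)] by simp
qed

section \<open>Bounded formulas for pairs and triples\<close>

definition Imp :: "bform \<Rightarrow> bform \<Rightarrow> bform" where
  "Imp p q = Neg (Conj p (Neg q))"
definition BEx :: "nat \<Rightarrow> nat \<Rightarrow> bform \<Rightarrow> bform" where
  "BEx i j p = Neg (BAll i j (Neg p))"
definition Iff :: "bform \<Rightarrow> bform \<Rightarrow> bform" where
  "Iff p q = Conj (Imp p q) (Imp q p)"

text \<open>The variables from 97 to 102 are reserved for the bound variables of these formulas.\<close>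

definition Is_pair :: "nat \<Rightarrow> nat \<Rightarrow> nat \<Rightarrow> bform" where
  "Is_pair p x y = BEx 100 p (BEx 101 p (Conj
     (BAll 102 p (Neg (Conj (Neg (Eq 102 100)) (Neg (Eq 102 101)))))
     (Conj (Conj (Mem x 100) (BAll 102 100 (Eq 102 x)))
       (Conj (Mem x 101) (Conj (Mem y 101)
         (BAll 102 101 (Neg (Conj (Neg (Eq 102 x)) (Neg (Eq 102 y))))))))))"
definition Pair_in :: "nat \<Rightarrow> nat \<Rightarrow> nat \<Rightarrow> bform" where
  "Pair_in x y s = BEx 99 s (Is_pair 99 x y)"
definition Triple_in :: "nat \<Rightarrow> nat \<Rightarrow> nat \<Rightarrow> nat \<Rightarrow> bform" where
  "Triple_in x y z s =
     BEx 99 s (BEx 98 99 (BEx 97 98 (Conj (Is_pair 97 x y) (Is_pair 99 97 z))))"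

lemma sat_simps [simp]:
  "sat U e (Imp p q) \<longleftrightarrow> (sat U e p \<longrightarrow> sat U e q)"
  "sat U e (Iff p q) \<longleftrightarrow> (sat U e p \<longleftrightarrow> sat U e q)"
  "sat U e (BEx i j p) \<longleftrightarrow> (\<exists>u. memb U u (e j) \<and> sat U (e(i := u)) p)"
  by (auto simp: Imp_def Iff_def BEx_def)

lemma sat_Is_pair [simp]:
  assumes "superstructure U" "p < 100" "x < 100" "y < 100"
  shows "sat U e (Is_pair p x y) \<longleftrightarrow> e p = opair U (e x) (e y)"
  unfolding eq_opair_iff[OF assms(1)] using assms(2-) by (simp add: Is_pair_def)

lemma sat_Pair_in [simp]:
  assumes "superstructure U" "x < 99" "y < 99" "s < 99"
  shows "sat U e (Pair_in x y s) \<longleftrightarrow> memb U (opair U (e x) (e y)) (e s)"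
  using assms by (auto simp: Pair_in_def)

lemma sat_Triple_in [simp]:
  assumes "superstructure U" "x < 97" "y < 97" "z < 97" "s < 97"
  shows "sat U e (Triple_in x y z s) \<longleftrightarrow>
    memb U (opair U (opair U (e x) (e y)) (e z)) (e s)"
proof -
  \<comment> \<open>The inner pair of a triple is reached through the singleton component of the
    outer pair, two membership steps down; hence the bound variables 98 and 97.\<close>
  have "memb U v (mkset U {v})" for v
    using memb_mkset_pair[OF assms(1), of v v v] by simp
  then have "\<exists>a. memb U a (opair U v w) \<and> memb U v a" for v w
    using memb_opair[OF assms(1), of _ v w] by auto
  then show ?thesis
    using assms by (auto simp: Triple_in_def)
qed

section \<open>Star functions evaluated at hyperreals, and the ultrafilters of hyperreals\<close>

lemma real_triple_coding:
  "\<exists>(p :: real \<Rightarrow> real) (q :: real \<Rightarrow> real) (s :: real \<Rightarrow> real). \<forall>x y z. \<exists>c. p c = x \<and> q c = y \<and> s c = z"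
proof -
  have inf: "infinite (UNIV :: real set)" by (rule infinite_UNIV_char_0)
  \<comment> \<open>The reals are equinumerous with their square; nesting this bijection packs a
    triple as \<open>h (x, h (y, z))\<close>.\<close>
  obtain h where h: "bij_betw h (UNIV \<times> UNIV :: (real \<times> real) set) (UNIV :: real set)"
    using card_of_ordIso[THEN iffD2, OF card_of_Times_same_infinite[OF inf]] by blast
  define g where "g = inv_into UNIV h"
  have g: "g (h z) = z" for z
    using h unfolding g_def bij_betw_def by simp
  show ?thesis
  proof (rule exI[of _ "fst \<circ> g"], rule exI[of _ "fst \<circ> g \<circ> snd \<circ> g"],
      rule exI[of _ "snd \<circ> g \<circ> snd \<circ> g"], intro allI)
    show "\<exists>c. (fst \<circ> g) c = x \<and> (fst \<circ> g \<circ> snd \<circ> g) c = y \<and> (snd \<circ> g \<circ> snd \<circ> g) c = z"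
      for x y z by (rule exI[of _ "h (x, h (y, z))"]) (simp add: g)
  qed
qed

definition set_obj :: "('v, 'w) nsmodel \<Rightarrow> real set \<Rightarrow> 'v" where
  "set_obj N A = mkset (std N) (emb N ` A)"
definition rel_obj :: "('v, 'w) nsmodel \<Rightarrow> (real \<Rightarrow> real \<Rightarrow> bool) \<Rightarrow> 'v" where
  "rel_obj N P = mkset (std N) {opair (std N) (emb N a) (emb N b) | a b. P a b}"
definition op_obj :: "('v, 'w) nsmodel \<Rightarrow> (real \<Rightarrow> real \<Rightarrow> real) \<Rightarrow> 'v" where
  "op_obj N f = mkset (std N)
     {opair (std N) (opair (std N) (emb N a) (emb N b)) (emb N (f a b)) | a b. True}"
abbreviation fun_obj :: "('v, 'w) nsmodel \<Rightarrow> (real \<Rightarrow> real) \<Rightarrow> 'v" where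
  "fun_obj N f \<equiv> rel_obj N (\<lambda>a b. b = f a)"

text \<open>
  For a fixed hyperreal \<open>c\<close> the sets \<open>A\<close> with \<open>c \<in> \<^sup>*A\<close> form an ultrafilter, and \<open>f \<mapsto> \<^sup>*f c\<close> maps the
  ultrapower of the reals modulo it into the hyperreals.  Any three hyperreals are in the image
  for some \<open>c\<close>, because one real number can encode three of them; hence the arithmetic of the
  hyperreals can be verified pointwise.
\<close>

definition ult :: "('v, 'w) nsmodel \<Rightarrow> 'w \<Rightarrow> real set \<Rightarrow> bool" where
  "ult N c A \<longleftrightarrow> memb (nonstd N) c (star N (set_obj N A))"
definition val :: "('v, 'w) nsmodel \<Rightarrow> (real \<Rightarrow> real) \<Rightarrow> 'w \<Rightarrow> 'w" where
  "val N f c =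
     (THE z. z \<in> hyperreals N \<and> memb (nonstd N) (opair (nonstd N) c z) (star N (fun_obj N f)))"

locale ns_model =
  fixes N :: "('v, 'w) nsmodel"
  assumes nonstandard: "nonstandard_model N"
begin

abbreviation H where "H \<equiv> hyperreals N"

lemma superstructure [simp]: "superstructure (std N)" "superstructure (nonstd N)"
  using nonstandard by (auto simp: nonstandard_model_def)

lemma emb_eq [simp]: "emb N a = emb N b \<longleftrightarrow> a = b"
  using nonstandard by (auto simp: nonstandard_model_def inj_def)

lemma emb_level: "emb N a \<in> level (std N) n"
proof -
  have "emb N a \<in> level (std N) 0"
    using nonstandard by (auto simp: nonstandard_model_def)
  then show ?thesis using level_mono[of 0 n "std N"] by auto
qed

lemma memb_set_obj [simp]: "memb (std N) z (set_obj N A) \<longleftrightarrow> (\<exists>a\<in>A. z = emb N a)"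
proof -
  have "emb N ` A \<subseteq> level (std N) 0" using emb_level by blast
  from memb_mkset(1)[OF superstructure(1) this] show ?thesis by (auto simp: set_obj_def)
qed

lemma memb_rel_obj:
  "memb (std N) z (rel_obj N P) \<longleftrightarrow> (\<exists>a b. z = opair (std N) (emb N a) (emb N b) \<and> P a b)"
proof -
  have "{opair (std N) (emb N a) (emb N b) | a b. P a b} \<subseteq> level (std N) 2"
    using level_opair[OF superstructure(1) emb_level[of _ 0] emb_level[of _ 0]]
    by (auto simp: numeral_2_eq_2 simp del: level.simps)
  from memb_mkset(1)[OF superstructure(1) this] show ?thesis by (auto simp: rel_obj_def)
qed

lemma opair_rel_obj [simp]:
  "memb (std N) (opair (std N) (emb N a) (emb N b)) (rel_obj N P) \<longleftrightarrow> P a b"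
  by (auto simp: memb_rel_obj opair_inject)

lemma memb_op_obj:
  "memb (std N) z (op_obj N f) \<longleftrightarrow>
    (\<exists>a b. z = opair (std N) (opair (std N) (emb N a) (emb N b)) (emb N (f a b)))"
proof -
  have "opair (std N) (emb N a) (emb N b) \<in> level (std N) 2" for a b
    using level_opair[OF superstructure(1) emb_level[of _ 0] emb_level[of _ 0]]
    by (simp add: numeral_2_eq_2 del: level.simps)
  from level_opair[OF superstructure(1) this emb_level]
  have "{opair (std N) (opair (std N) (emb N a) (emb N b)) (emb N (f a b)) | a b. True}
      \<subseteq> level (std N) (Suc (Suc 2))"
    by (auto simp del: level.simps)
  from memb_mkset(1)[OF superstructure(1) this] show ?thesis by (auto simp: op_obj_def)
qed

lemma opair_op_obj [simp]:
  "memb (std N) (opair (std N) (opair (std N) (emb N a) (emb N b)) (emb N d)) (op_obj N f) \<longleftrightarrow>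
    d = f a b"
  by (auto simp: memb_op_obj opair_inject)

lemma transferI: "sat (std N) e p \<Longrightarrow> sat (nonstd N) (star N \<circ> e) p"
  using nonstandard unfolding nonstandard_model_def transfer_def by blast

lemma memb_star: "memb (std N) x y \<Longrightarrow> memb (nonstd N) (star N x) (star N y)"
  using transferI[of "(\<lambda>_. y)(0 := x)" "Mem 0 1"] by simp

lemma memb_star_UNIV [simp]: "memb (nonstd N) x (star N (set_obj N UNIV)) \<longleftrightarrow> x \<in> H"
  using nonstandard unfolding nonstandard_model_def set_obj_def by blast

lemma ult_UNIV [simp]: "ult N c UNIV \<longleftrightarrow> c \<in> H"
  by (simp add: ult_def)

lemma hreal_hyperreal [simp]: "hreal N r \<in> H"
  using memb_star[of "emb N r" "set_obj N UNIV"] by (simp add: hreal_def)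

text \<open>The inclusion is a bounded sentence and transfers; closure under intersections and under
  supersets come together. Here and in the later transfer arguments variable 0 takes the default
  value of the assignment, updated variables from 1 on are further parameters, and bound variables
  start at 10.\<close>

lemma ult_inter:
  assumes "ult N c A" "ult N c B" "A \<inter> B \<subseteq> C"
  shows "ult N c C"
proof -
  have "sat (std N) ((\<lambda>_. set_obj N A)(1 := set_obj N B, 2 := set_obj N C))
    (BAll 10 0 (Imp (Mem 10 1) (Mem 10 2)))"
    using assms(3) by auto
  from transferI[OF this] assms show ?thesis by (simp add: ult_def)
qed

lemma ult_mono: "ult N c A \<Longrightarrow> A \<subseteq> B \<Longrightarrow> ult N c B"
  using ult_inter[of c A A B] by auto

lemma not_ult_empty: "\<not> ult N c {}"
  using transferI[of "\<lambda>_. set_obj N {}" "BAll 10 0 (Neg (Eq 10 10))"] by (auto simp: ult_def)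

lemma ult_disjointD: "ult N c A \<Longrightarrow> ult N c B \<Longrightarrow> A \<inter> B \<noteq> {}"
  using ult_inter[of c A B "{}"] not_ult_empty[of c] by auto

definition graph_memb where
  "graph_memb P x y \<longleftrightarrow> memb (nonstd N) (opair (nonstd N) x y) (star N (rel_obj N P))"

lemma fun_total: "c \<in> H \<Longrightarrow> \<exists>z\<in>H. graph_memb (\<lambda>a b. b = f a) c z"
proof -
  assume c: "c \<in> H"
  have "sat (std N) ((\<lambda>_. set_obj N UNIV)(1 := fun_obj N f)) (BAll 10 0 (BEx 11 0 (Pair_in 10 11 1)))"
    by auto
  from transferI[OF this] c show ?thesis by (auto simp: graph_memb_def)
qed

text \<open>The agreement set of \<open>f\<close> and \<open>g\<close> is itself an object of the
  superstructure, so membership in it can be compared with equality of values in one bounded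
  sentence. Its transfer, read at \<open>c\<close>, is the theorem of Los for equality;
  \<open>fun_rel_iff_ult\<close> is the analogue for a binary relation.\<close>

lemma fun_eq_iff_ult:
  assumes "c \<in> H" "u \<in> H" "v \<in> H" "graph_memb (\<lambda>a b. b = f a) c u" "graph_memb (\<lambda>a b. b = g a) c v"
  shows "u = v \<longleftrightarrow> ult N c {t. f t = g t}"
proof -
  have "sat (std N) ((\<lambda>_. set_obj N UNIV)(1 := fun_obj N f, 2 := fun_obj N g,
      3 := set_obj N {t. f t = g t})) (BAll 10 0 (BAll 11 0 (BAll 12 0
      (Imp (Conj (Pair_in 10 11 1) (Pair_in 10 12 2)) (Iff (Mem 10 3) (Eq 11 12))))))"
    by auto
  from transferI[OF this] show ?thesis
    using assms by (auto simp: graph_memb_def ult_def)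
qed

lemma fun_rel_iff_ult:
  assumes "c \<in> H" "u \<in> H" "v \<in> H" "graph_memb (\<lambda>a b. b = f a) c u" "graph_memb (\<lambda>a b. b = g a) c v"
  shows "graph_memb P u v \<longleftrightarrow> ult N c {t. P (f t) (g t)}"
proof -
  have "sat (std N) ((\<lambda>_. set_obj N UNIV)(1 := fun_obj N f, 2 := fun_obj N g,
      3 := set_obj N {t. P (f t) (g t)}, 4 := rel_obj N P)) (BAll 10 0 (BAll 11 0 (BAll 12 0
      (Imp (Conj (Pair_in 10 11 1) (Pair_in 10 12 2)) (Iff (Mem 10 3) (Pair_in 11 12 4))))))"
    by auto
  from transferI[OF this] show ?thesis
    using assms by (auto simp: graph_memb_def ult_def)
qed

lemma val_props:
  assumes "c \<in> H"
  shows "val N f c \<in> H" "graph_memb (\<lambda>a b. b = f a) c (val N f c)"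
proof -
  \<comment> \<open>With \<open>g = f\<close> the agreement set is the whole line, which gives
    uniqueness.\<close>
  have "\<exists>!z. z \<in> H \<and> graph_memb (\<lambda>a b. b = f a) c z"
    using fun_total[OF assms, of f] fun_eq_iff_ult[OF assms, of _ _ f f] assms by auto
  from theI'[OF this] show "val N f c \<in> H" "graph_memb (\<lambda>a b. b = f a) c (val N f c)"
    by (auto simp: val_def graph_memb_def)
qed

lemmas val_hyperreal [simp] = val_props(1)

lemma val_eqI:
  "c \<in> H \<Longrightarrow> z \<in> H \<Longrightarrow> graph_memb (\<lambda>a b. b = f a) c z \<Longrightarrow> val N f c = z"
  using fun_eq_iff_ult[of c "val N f c" z f f] val_props[of c f] by simp

lemma val_eq_iff: "c \<in> H \<Longrightarrow> val N f c = val N g c \<longleftrightarrow> ult N c {t. f t = g t}"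
  by (intro fun_eq_iff_ult val_props)

lemma graph_memb_val:
  "c \<in> H \<Longrightarrow> graph_memb P (val N f c) (val N g c) \<longleftrightarrow> ult N c {t. P (f t) (g t)}"
  by (intro fun_rel_iff_ult val_props)

lemma hless_val: "c \<in> H \<Longrightarrow> hless N (val N f c) (val N g c) \<longleftrightarrow> ult N c {t. f t < g t}"
  using graph_memb_val[of c "(<)"] by (simp add: graph_memb_def hless_def rel_obj_def)

lemma val_const: "c \<in> H \<Longrightarrow> val N (\<lambda>_. r) c = hreal N r"
proof (rule val_eqI)
  assume c: "c \<in> H"
  have "sat (std N) ((\<lambda>_. set_obj N UNIV)(1 := rel_obj N (\<lambda>a b. b = r), 2 := emb N r))
    (BAll 10 0 (Pair_in 10 2 1))"
    by auto
  from transferI[OF this] c show "graph_memb (\<lambda>a b. b = r) c (hreal N r)"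
    by (auto simp: graph_memb_def hreal_def)
qed auto

lemma hyperreal_triple_cases:
  assumes "x \<in> H" "y \<in> H" "z \<in> H"
  obtains c f g h where "c \<in> H" "x = val N f c" "y = val N g c" "z = val N h c"
proof -
  obtain p q s :: "real \<Rightarrow> real" where pqs: "\<forall>x y z. \<exists>c. p c = x \<and> q c = y \<and> s c = z"
    using real_triple_coding by blast
  have "sat (std N) ((\<lambda>_. set_obj N UNIV)(1 := fun_obj N p, 2 := fun_obj N q, 3 := fun_obj N s))
    (BAll 10 0 (BAll 11 0 (BAll 12 0 (BEx 13 0 (Conj (Pair_in 13 10 1)
       (Conj (Pair_in 13 11 2) (Pair_in 13 12 3)))))))"
  proof -
    have "\<exists>u. (\<exists>a. u = emb N a) \<and> memb (std N) (opair (std N) u (emb N x)) (fun_obj N p) \<and>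
        memb (std N) (opair (std N) u (emb N y)) (fun_obj N q) \<and>
        memb (std N) (opair (std N) u (emb N z)) (fun_obj N s)" for x y z
    proof -
      obtain d where "p d = x \<and> q d = y \<and> s d = z" using pqs by blast
      then show ?thesis by (intro exI[of _ "emb N d"]) auto
    qed
    then show ?thesis by auto
  qed
  from transferI[OF this] assms obtain c where c: "c \<in> H" "graph_memb (\<lambda>a b. b = p a) c x"
      "graph_memb (\<lambda>a b. b = q a) c y" "graph_memb (\<lambda>a b. b = s a) c z"
    unfolding graph_memb_def by simp meson
  show ?thesis
    using that[OF c(1)] val_eqI[OF c(1) assms(1) c(2)] val_eqI[OF c(1) assms(2) c(3)]
      val_eqI[OF c(1) assms(3) c(4)] by blast
qed

lemma star_rel_elem:
  assumes "memb (nonstd N) z (star N (rel_obj N P))"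
  obtains x y where "x \<in> H" "y \<in> H" "z = opair (nonstd N) x y" "graph_memb P x y"
proof -
  have "sat (std N) ((\<lambda>_. set_obj N UNIV)(1 := rel_obj N P))
    (BAll 10 1 (BEx 11 0 (BEx 12 0 (Is_pair 10 11 12))))"
    by (auto simp: memb_rel_obj)
  from transferI[OF this] assms that show ?thesis
    by (auto simp: graph_memb_def)
qed

text \<open>Three transferred sentences: the proposed value works, two hyperreal values coincide,
  and every candidate is a hyperreal. The third is there because the description in
  \<open>star_fun2\<close> ranges over all objects of the universe.\<close>

lemma star_fun2_val:
  assumes c: "c \<in> H"
  shows "star_fun2 N F (val N f c) (val N g c) = val N (\<lambda>t. F (f t) (g t)) c"
proof -
  let ?t = "\<lambda>z. opair (nonstd N) (opair (nonstd N) (val N f c) (val N g c)) z"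
  let ?G = "star N (op_obj N F)"
  have "sat (std N) ((\<lambda>_. set_obj N UNIV)(1 := fun_obj N f, 2 := fun_obj N g,
      3 := fun_obj N (\<lambda>t. F (f t) (g t)), 4 := op_obj N F))
      (BAll 10 0 (BAll 11 0 (BAll 12 0 (BAll 13 0
      (Imp (Conj (Pair_in 10 11 1) (Conj (Pair_in 10 12 2) (Pair_in 10 13 3)))
        (Triple_in 11 12 13 4))))))"
    by auto
  from transferI[OF this] have ex: "memb (nonstd N) (?t (val N (\<lambda>t. F (f t) (g t)) c)) ?G"
    using c val_props[OF c] by (auto simp: graph_memb_def)
  have "sat (std N) ((\<lambda>_. set_obj N UNIV)(4 := op_obj N F))
      (BAll 11 0 (BAll 12 0 (BAll 13 0 (BAll 14 0
      (Imp (Conj (Triple_in 11 12 13 4) (Triple_in 11 12 14 4)) (Eq 13 14))))))"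
    by auto
  from transferI[OF this]
  have "\<forall>u\<in>H. \<forall>v\<in>H. \<forall>z\<in>H. \<forall>z'\<in>H.
      memb (nonstd N) (opair (nonstd N) (opair (nonstd N) u v) z) ?G \<and>
      memb (nonstd N) (opair (nonstd N) (opair (nonstd N) u v) z') ?G \<longrightarrow> z = z'"
    by (simp add: Ball_def)
  then have uniq: "z = z'"
    if "z \<in> H" "z' \<in> H" "memb (nonstd N) (?t z) ?G" "memb (nonstd N) (?t z') ?G" for z z'
    using that val_hyperreal[OF c] by meson
  have *: "\<exists>a. memb U a (opair U v w) \<and> memb U v a" if "superstructure U" for U :: "'u universe" and v w
    using memb_opair[OF that, of _ v w] memb_mkset_pair[OF that, of v v v] by auto
  have "sat (std N) ((\<lambda>_. set_obj N UNIV)(4 := op_obj N F))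
      (BAll 10 4 (BEx 98 10 (BEx 11 98 (BEx 12 0 (Is_pair 10 11 12)))))"
    using *[of "std N"] by (auto simp: memb_op_obj opair_inject)
  from transferI[OF this] have "z \<in> H" if "memb (nonstd N) (?t z) ?G" for z
    using that by (auto simp: opair_inject)
  then show ?thesis
    using ex uniq unfolding star_fun2_def op_obj_def[symmetric]
    by (intro the_equality) (auto simp: c)
qed

lemma internal_star: "internal N (star N B)"
proof -
  have "memb (std N) B (mkset (std N) {B})"
    using memb_mkset_pair[of "std N" B B B] by simp
  then show ?thesis unfolding internal_def using memb_star by blast
qed

end

section \<open>Hyperreals\<close>

text \<open>The difference \<open>g\<close> between \<psi> and the linear map with the same value at
  1 is additive and vanishes on the rationals. Choosing a rational within \<open>d\<close> of
  \<open>k * r\<close> turns \<open>k * g r\<close> into a value of \<open>g\<close> on the interval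
  of radius \<open>d\<close>, where \<open>g\<close> is bounded; as \<open>k\<close> is arbitrary,
  \<open>g r = 0\<close>.\<close>

lemma additive_bounded_imp_linear:
  fixes \<psi> :: "real \<Rightarrow> real"
  assumes add: "\<And>x y. \<psi> (x + y) = \<psi> x + \<psi> y"
    and d: "d > 0" and bnd: "\<And>r. \<bar>r\<bar> < d \<Longrightarrow> \<bar>\<psi> r\<bar> \<le> C"
  shows "\<psi> r = \<psi> 1 * r"
proof -
  have zero: "\<psi> 0 = 0" using add[of 0 0] by simp
  have minus: "\<psi> (- x) = - \<psi> x" for x using add[of x "- x"] zero by simp
  have nat: "\<psi> (of_nat n * x) = of_nat n * \<psi> x" for n x
    by (induction n) (auto simp: zero add algebra_simps)
  have int: "\<psi> (of_int k * x) = of_int k * \<psi> x" for k x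
  proof (cases k)
    case (nonneg n) then show ?thesis using nat[of n x] by simp
  next
    case (neg n)
    then have "of_int k = - (of_nat (Suc n) :: real)" by simp
    then have k: "of_int k * y = - (of_nat (Suc n) * y)" for y :: real
      by (metis mult_minus_left)
    show ?thesis unfolding k minus nat ..
  qed
  have rat: "\<psi> (of_int a / of_int b) = \<psi> 1 * (of_int a / of_int b)" if "b \<noteq> 0" for a b
    using int[of b "of_int a / of_int b"] int[of a 1] that by (simp add: field_simps)
  define g where "g = (\<lambda>x. \<psi> x - \<psi> 1 * x)"
  have bound: "of_nat k * \<bar>g r\<bar> \<le> C + \<bar>\<psi> 1\<bar> * d" for k :: nat
  proof -
    have "of_nat k * r - d / 2 < of_nat k * r" using d by simp
    from of_rat_dense[OF this] obtain q
      where q: "of_nat k * r - d / 2 < of_rat q" "of_rat q < of_nat k * r" by blast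
    obtain a b where "q = Fract a b" "b > 0" by (cases q) auto
    then have "(of_rat q :: real) = of_int a / of_int b" "b \<noteq> 0" by (auto simp: of_rat_rat)
    then have gq: "\<psi> (of_rat q) = \<psi> 1 * of_rat q" using rat by metis
    let ?e = "of_nat k * r - of_rat q"
    have e: "\<bar>?e\<bar> < d" using q d by linarith
    have "of_nat k * g r = \<psi> ?e - \<psi> 1 * ?e"
      using nat[of k r] gq add[of "?e" "of_rat q"] by (simp add: g_def algebra_simps)
    moreover have "\<bar>\<psi> 1 * ?e\<bar> \<le> \<bar>\<psi> 1\<bar> * d"
      using e by (simp add: abs_mult mult_left_mono)
    ultimately have "\<bar>of_nat k * g r\<bar> \<le> C + \<bar>\<psi> 1\<bar> * d"
      using bnd[OF e] by linarith
    then show ?thesis by (simp add: abs_mult)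
  qed
  have "g r = 0"
  proof (rule ccontr)
    assume "g r \<noteq> 0"
    then obtain k :: nat where "C + \<bar>\<psi> 1\<bar> * d < of_nat k * \<bar>g r\<bar>"
      using reals_Archimedean3[of "\<bar>g r\<bar>"] by auto
    with bound[of k] show False by linarith
  qed
  then show ?thesis by (simp add: g_def)
qed

context ns_model
begin

section \<open>Hyperreal addition, near-standard points and standard parts\<close>

abbreviation hadd (infixl "\<oplus>\<^sub>H" 65) where "x \<oplus>\<^sub>H y \<equiv> star_fun2 N (+) x y"

lemma hadd_closed [simp]: "x \<in> H \<Longrightarrow> y \<in> H \<Longrightarrow> x \<oplus>\<^sub>H y \<in> H"
  by (rule hyperreal_triple_cases[of x y y]) (auto simp: star_fun2_val)

lemma hadd_assoc: "x \<in> H \<Longrightarrow> y \<in> H \<Longrightarrow> z \<in> H \<Longrightarrow> x \<oplus>\<^sub>H y \<oplus>\<^sub>H z = x \<oplus>\<^sub>H (y \<oplus>\<^sub>H z)"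
  by (rule hyperreal_triple_cases[of x y z]) (auto simp: star_fun2_val add.assoc)

text \<open>When only constant functions occur, any hyperreal can serve as the evaluation point;
  \<open>hreal N 0\<close> is taken.\<close>

lemma hreal_add: "hreal N (r + s) = hreal N r \<oplus>\<^sub>H hreal N s"
  using hreal_hyperreal[of 0] val_const[of "hreal N 0"]
    star_fun2_val[of "hreal N 0" "(+)" "\<lambda>_. r" "\<lambda>_. s"] by simp

lemma hadd_zero: "x \<in> H \<Longrightarrow> hreal N 0 \<oplus>\<^sub>H x = x"
proof (rule hyperreal_triple_cases[of x x x])
  fix c f assume c: "c \<in> H" and "x = val N f c"
  then show "hreal N 0 \<oplus>\<^sub>H x = x"
    using val_const[OF c, of 0] star_fun2_val[OF c, of "(+)" "\<lambda>_. 0" f] by simp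
qed

text \<open>A standard real is the value of a constant function at the same \<open>c\<close>.
  Closeness thus becomes an epsilon condition on the ultrafilter of \<open>c\<close>, and all later
  estimates concern ordinary reals \<open>f t\<close>.\<close>

lemma infinitely_close_val:
  assumes c: "c \<in> H"
  shows "infinitely_close N (val N f c) (hreal N r) \<longleftrightarrow> (\<forall>\<epsilon>>0. ult N c {t. \<bar>f t - r\<bar> < \<epsilon>})"
  unfolding infinitely_close_def val_const[OF c, symmetric] star_fun2_val[OF c] hless_val[OF c] ..

text \<open>Intervals around \<open>r\<close> and \<open>s\<close> of radius half their distance are
  disjoint, but their preimages under \<open>f\<close> would both lie in the ultrafilter of
  \<open>c\<close>.\<close>

lemma infinitely_close_unique:
  assumes "x \<in> H" "infinitely_close N x (hreal N r)" "infinitely_close N x (hreal N s)"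
  shows "r = s"
proof (rule ccontr)
  assume "r \<noteq> s"
  then have pos: "\<bar>r - s\<bar> / 2 > 0" by simp
  obtain c f where cf: "c \<in> H" "x = val N f c"
    by (rule hyperreal_triple_cases[OF assms(1,1,1)])
  have "ult N c {t. \<bar>f t - r\<bar> < \<bar>r - s\<bar> / 2}" "ult N c {t. \<bar>f t - s\<bar> < \<bar>r - s\<bar> / 2}"
    using assms(2,3) pos unfolding cf(2) infinitely_close_val[OF cf(1)] by blast+
  from ult_disjointD[OF this] obtain t
    where t: "\<bar>f t - r\<bar> < \<bar>r - s\<bar> / 2" "\<bar>f t - s\<bar> < \<bar>r - s\<bar> / 2"
    by blast
  have "\<bar>r - s\<bar> \<le> \<bar>f t - r\<bar> + \<bar>f t - s\<bar>"
    using abs_triangle_ineq[of "r - f t" "f t - s"] by (simp add: abs_minus_commute)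
  also have "\<dots> < \<bar>r - s\<bar>"
    using add_strict_mono[OF t] by simp
  finally show False by simp
qed

lemma st_eqI: "x \<in> H \<Longrightarrow> infinitely_close N x (hreal N r) \<Longrightarrow> st N x = r"
  unfolding st_def using infinitely_close_unique by blast

lemma nst_st:
  assumes "x \<in> nst N"
  shows "x \<in> H" "infinitely_close N x (hreal N (st N x))"
  using assms st_eqI unfolding nst_def by force+

lemma nstI: "x \<in> H \<Longrightarrow> infinitely_close N x (hreal N r) \<Longrightarrow> x \<in> nst N"
  unfolding nst_def by blast

lemma infinitely_close_hadd:
  assumes "x \<in> H" "y \<in> H" "infinitely_close N x (hreal N r)" "infinitely_close N y (hreal N s)"
  shows "infinitely_close N (x \<oplus>\<^sub>H y) (hreal N (r + s))"
proof -
  obtain c f g where cf: "c \<in> H" "x = val N f c" "y = val N g c"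
    by (rule hyperreal_triple_cases[OF assms(1,2,2)])
  show ?thesis
    unfolding cf star_fun2_val[OF cf(1)] infinitely_close_val[OF cf(1)]
  proof (intro allI impI)
    fix \<epsilon> :: real assume \<epsilon>: "\<epsilon> > 0"
    have sub: "{t. \<bar>f t - r\<bar> < \<epsilon> / 2} \<inter> {t. \<bar>g t - s\<bar> < \<epsilon> / 2} \<subseteq> {t. \<bar>f t + g t - (r + s)\<bar> < \<epsilon>}"
    proof clarify
      fix t assume t: "\<bar>f t - r\<bar> < \<epsilon> / 2" "\<bar>g t - s\<bar> < \<epsilon> / 2"
      have "\<bar>f t + g t - (r + s)\<bar> \<le> \<bar>f t - r\<bar> + \<bar>g t - s\<bar>"
        using abs_triangle_ineq[of "f t - r" "g t - s"] by (simp add: algebra_simps)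
      also have "\<dots> < \<epsilon>" using add_strict_mono[OF t] by simp
      finally show "\<bar>f t + g t - (r + s)\<bar> < \<epsilon>" .
    qed
    have "ult N c {t. \<bar>f t - r\<bar> < \<epsilon> / 2}" "ult N c {t. \<bar>g t - s\<bar> < \<epsilon> / 2}"
      using assms(3,4) half_gt_zero[OF \<epsilon>] unfolding cf(2,3) infinitely_close_val[OF cf(1)] by blast+
    then show "ult N c {t. \<bar>f t + g t - (r + s)\<bar> < \<epsilon>}"
      using sub by (rule ult_inter)
  qed
qed

lemma nst_hadd:
  assumes "x \<in> nst N" "y \<in> nst N"
  shows "x \<oplus>\<^sub>H y \<in> nst N" "st N (x \<oplus>\<^sub>H y) = st N x + st N y"
proof -
  note x = nst_st[OF assms(1)] and y = nst_st[OF assms(2)]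
  note xy = infinitely_close_hadd[OF x(1) y(1) x(2) y(2)]
  from nstI[OF _ xy] st_eqI[OF _ xy] x(1) y(1)
  show "x \<oplus>\<^sub>H y \<in> nst N" "st N (x \<oplus>\<^sub>H y) = st N x + st N y"
    by simp_all
qed

lemma infinitely_close_hreal: "infinitely_close N (hreal N r) (hreal N r)"
  using infinitely_close_val[of "hreal N 0" "\<lambda>_. r" r] val_const[of "hreal N 0" r] by simp

lemma nst_hreal [simp]: "hreal N r \<in> nst N" "st N (hreal N r) = r"
  using nstI[OF _ infinitely_close_hreal] st_eqI[OF _ infinitely_close_hreal] by simp_all

section \<open>Scaling maps on the hyperreals and their internal graphs\<close>

lemma val_val: "c \<in> H \<Longrightarrow> val N f (val N g c) = val N (\<lambda>t. f (g t)) c"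
  by (intro val_eqI) (auto simp: graph_memb_val)

lemma val_scale_hadd:
  assumes "x \<in> H" "y \<in> H"
  shows "val N ((*) \<alpha>) (x \<oplus>\<^sub>H y) = val N ((*) \<alpha>) x \<oplus>\<^sub>H val N ((*) \<alpha>) y"
  by (rule hyperreal_triple_cases[OF assms assms(2)])
    (auto simp: star_fun2_val val_val distrib_left)

lemma val_hreal: "val N f (hreal N r) = hreal N (f r)"
  using val_val[of "hreal N 0" f "\<lambda>_. r"] val_const[of "hreal N 0"] by simp

lemma nst_scale:
  assumes "x \<in> nst N"
  shows "val N ((*) \<alpha>) x \<in> nst N" "st N (val N ((*) \<alpha>) x) = \<alpha> * st N x"
proof -
  note x = nst_st[OF assms]
  obtain c f where cf: "c \<in> H" "x = val N f c"
    by (rule hyperreal_triple_cases[OF x(1,1,1)])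
  have "ult N c {t. \<bar>\<alpha> * f t - \<alpha> * st N x\<bar> < \<epsilon>}" if "\<epsilon> > 0" for \<epsilon>
  \<comment> \<open>Adding 1 to the absolute value of \<alpha> keeps the denominator positive when
    \<alpha> is 0.\<close>
  proof (rule ult_mono[of c "{t. \<bar>f t - st N x\<bar> < \<epsilon> / (\<bar>\<alpha>\<bar> + 1)}"])
    show "ult N c {t. \<bar>f t - st N x\<bar> < \<epsilon> / (\<bar>\<alpha>\<bar> + 1)}"
      using x(2) that cf infinitely_close_val[OF cf(1)] by simp
    show "{t. \<bar>f t - st N x\<bar> < \<epsilon> / (\<bar>\<alpha>\<bar> + 1)} \<subseteq> {t. \<bar>\<alpha> * f t - \<alpha> * st N x\<bar> < \<epsilon>}"
    proof clarify
      fix t assume t: "\<bar>f t - st N x\<bar> < \<epsilon> / (\<bar>\<alpha>\<bar> + 1)"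
      have "\<bar>\<alpha> * f t - \<alpha> * st N x\<bar> = \<bar>\<alpha>\<bar> * \<bar>f t - st N x\<bar>"
        by (simp add: abs_mult[symmetric] algebra_simps)
      also have "\<dots> \<le> (\<bar>\<alpha>\<bar> + 1) * \<bar>f t - st N x\<bar>" by (intro mult_right_mono) auto
      also have "\<dots> < \<epsilon>" using t by (simp add: field_simps)
      finally show "\<bar>\<alpha> * f t - \<alpha> * st N x\<bar> < \<epsilon>" .
    qed
  qed
  then have "infinitely_close N (val N ((*) \<alpha>) x) (hreal N (\<alpha> * st N x))"
    using cf infinitely_close_val[OF cf(1)] val_val[OF cf(1)] by simp
  from nstI[OF _ this] st_eqI[OF _ this] x(1)
  show "val N ((*) \<alpha>) x \<in> nst N" "st N (val N ((*) \<alpha>) x) = \<alpha> * st N x"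
    by simp_all
qed

text \<open>Members of the star of a graph are pairs of hyperreals by \<open>star_rel_elem\<close>,
  and \<open>val_eqI\<close> fixes the second entry. The star form makes the graph internal, as
  \<open>hyper_hom\<close> demands of the scaling maps.\<close>

lemma graph_eq_star:
  "mkset (nonstd N) {opair (nonstd N) x (val N f x) | x. x \<in> H} = star N (fun_obj N f)"
  (is "mkset _ ?G = _")
proof (rule memb_ext[OF superstructure(2)])
  have "?G \<subseteq> level (nonstd N) (Suc (Suc 0))"
    using level_opair[OF superstructure(2), of _ 0] by (auto simp del: level.simps(2))
  note G = memb_mkset[OF superstructure(2) this]
  show "mkset (nonstd N) ?G \<notin> H" by (rule G)
  have "graph_memb (\<lambda>a b. b = f a) x (val N f x)" if "x \<in> H" for x
    using val_props(2)[OF that] .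
  then show iff: "memb (nonstd N) z (mkset (nonstd N) ?G) \<longleftrightarrow> memb (nonstd N) z (star N (fun_obj N f))" for z
    unfolding G using val_eqI star_rel_elem[of z "\<lambda>a b. b = f a"] unfolding graph_memb_def mem_Collect_eq by metis
  \<comment> \<open>Extensionality holds for non-atoms only. An object with a member cannot be an
    atom, so one point of the graph suffices.\<close>
  have "opair (nonstd N) (hreal N 0) (val N f (hreal N 0)) \<in> ?G" by auto
  then show "star N (fun_obj N f) \<notin> H"
    using iff G(1) memb_not_atom[OF superstructure(2)] by blast
qed

section \<open>Standard parts of internal homomorphisms\<close>

lemma hyper_homD:
  assumes "hyper_hom N L M \<phi>"
  shows "x \<in> H \<Longrightarrow> \<phi> x \<in> H"
    and "x \<in> H \<Longrightarrow> y \<in> H \<Longrightarrow> \<phi> (x \<oplus>\<^sub>H y) = \<phi> x \<oplus>\<^sub>H \<phi> y"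
    and "x \<in> nst N \<Longrightarrow> \<phi> x \<in> nst N"
  using assms by (auto simp: hyper_hom_def hom_def hyper_group_def)

text \<open>
  An unbounded \<open>\<phi>\<close> would by saturation have a point of its graph in all the sets
  \<open>\<^sup>*{(a, b). \<bar>a\<bar> < 1 / (n + 1) \<and> \<bar>b\<bar> > n}\<close>, that is, an infinitesimal with an infinite image.
\<close>

lemma hyper_hom_bounded_near_zero:
  assumes \<phi>: "hyper_hom N L M \<phi>"
  shows "\<exists>n. \<forall>r. \<bar>r\<bar> < 1 / real (Suc n) \<longrightarrow> \<bar>st N (\<phi> (hreal N r))\<bar> \<le> real (Suc n)"
proof (rule ccontr)
  assume "\<not> ?thesis"
  then have unbounded: "\<exists>r. \<bar>r\<bar> < 1 / real (Suc n) \<and> \<bar>st N (\<phi> (hreal N r))\<bar> > real (Suc n)" for n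
    by (meson not_less)
  define G where "G = mkset (nonstd N) {opair (nonstd N) x (\<phi> x) | x. x \<in> H}"
  have "{opair (nonstd N) x (\<phi> x) | x. x \<in> H} \<subseteq> level (nonstd N) (Suc (Suc 0))"
    using level_opair[OF superstructure(2), of _ 0] hyper_homD(1)[OF \<phi>] by (auto simp del: level.simps(2))
  from memb_mkset(1)[OF superstructure(2) this] have G: "memb (nonstd N) z G \<longleftrightarrow> (\<exists>x\<in>H. z = opair (nonstd N) x (\<phi> x))" for z
    unfolding G_def by auto
  \<comment> \<open>The bound on \<open>b\<close> is \<open>n\<close>, one less than what
    \<open>unbounded\<close> offers: the slack absorbs the distance between a hyperreal image and
    its standard part.\<close>
  define P where "P = (\<lambda>n (a::real) b. \<bar>a\<bar> < 1 / real (Suc n) \<and> \<bar>b\<bar> > real n)"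
  define F where "F = (\<lambda>n. case n of 0 \<Rightarrow> G | Suc n \<Rightarrow> star N (rel_obj N (P n)))"
  have "internal N (F n)" for n
    using \<phi> internal_star by (auto simp: F_def G_def hyper_hom_def split: nat.split)
  moreover have "\<exists>z. \<forall>n\<in>I. memb (nonstd N) z (F n)" if "finite I" for I
  proof -
    \<comment> \<open>Relation \<open>n\<close> sits at index \<open>Suc n\<close> of
      \<open>F\<close>, index 0 being the graph. So \<open>m\<close> exceeds every \<open>n\<close>
      that occurs in \<open>I\<close>, and one point chosen for \<open>m\<close> serves them all;
      inserting 0 makes the maximum meaningful for empty \<open>I\<close>.\<close>
    define m where "m = Max (insert 0 I)"
    obtain r where r: "\<bar>r\<bar> < 1 / real (Suc m)" "\<bar>st N (\<phi> (hreal N r))\<bar> > real (Suc m)"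
      using unbounded by blast
    define s where "s = st N (\<phi> (hreal N r))"
    have y: "\<phi> (hreal N r) \<in> H" "infinitely_close N (\<phi> (hreal N r)) (hreal N s)"
      unfolding s_def using nst_st[OF hyper_homD(3)[OF \<phi> nst_hreal(1)]] by auto
    obtain c f g where c: "c \<in> H" and f: "hreal N r = val N f c" and g: "\<phi> (hreal N r) = val N g c"
      by (rule hyperreal_triple_cases[OF hreal_hyperreal y(1) y(1)])
    have ult_f: "ult N c {t. f t = r}"
      using val_eq_iff[OF c, of f "\<lambda>_. r"] val_const[OF c, of r] f by simp
    have ult_g: "ult N c {t. \<bar>g t - s\<bar> < 1}"
      using y(2) zero_less_one unfolding g infinitely_close_val[OF c] by blast
    have "graph_memb (P n) (hreal N r) (\<phi> (hreal N r))" if "n < m" for n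
      unfolding g unfolding f graph_memb_val[OF c]
    proof (rule ult_inter[OF ult_f ult_g], clarify)
      fix t assume t: "\<bar>g t - s\<bar> < 1" "r = f t"
      have "1 / real (Suc m) \<le> 1 / real (Suc n)" using \<open>n < m\<close> by (simp add: field_simps)
      moreover have "\<bar>s\<bar> > real (Suc m)" using r(2) by (simp add: s_def)
      ultimately show "P n (f t) (g t)"
        using t r(1) \<open>n < m\<close> unfolding P_def by linarith
    qed
    moreover have "n < m" if "Suc n \<in> I" for n
    proof -
      have "Suc n \<le> m" unfolding m_def using \<open>finite I\<close> that by (intro Max_ge) auto
      then show ?thesis by simp
    qed
    ultimately have "memb (nonstd N) (opair (nonstd N) (hreal N r) (\<phi> (hreal N r))) (F n)" if "n \<in> I" for n
      using that G by (auto simp: F_def graph_memb_def split: nat.split)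
    then show ?thesis by blast
  qed
  ultimately obtain z where z: "memb (nonstd N) z (F n)" for n
    using nonstandard unfolding nonstandard_model_def saturated_def by metis
  obtain x where x: "x \<in> H" "z = opair (nonstd N) x (\<phi> x)"
    using z[of 0] G by (auto simp: F_def)
  obtain c f g where c: "c \<in> H" and f: "x = val N f c" and g: "\<phi> x = val N g c"
    by (rule hyperreal_triple_cases[OF x(1) hyper_homD(1)[OF \<phi> x(1)] x(1)])
  have P: "ult N c {t. P n (f t) (g t)}" for n
    using z[of "Suc n"] graph_memb_val[OF c, of "P n" f g] f g x(2) by (simp add: F_def graph_memb_def)
  have "ult N c {t. \<bar>f t - 0\<bar> < \<epsilon>}" if "\<epsilon> > 0" for \<epsilon>
  proof -
    obtain n where "1 / real (Suc n) < \<epsilon>" using nat_approx_posE[OF \<open>\<epsilon> > 0\<close>] by blast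
    then show ?thesis by (intro ult_mono[OF P[of n]]) (auto simp: P_def)
  qed
  then have "x \<in> nst N"
    using infinitely_close_val[OF c, of f 0] f x(1) nstI by blast
  from nst_st(2)[OF hyper_homD(3)[OF \<phi> this]]
  have g1: "ult N c {t. \<bar>g t - st N (\<phi> x)\<bar> < 1}"
    using zero_less_one unfolding g infinitely_close_val[OF c] by blast
  obtain n where "\<bar>st N (\<phi> x)\<bar> + 1 < real n" using reals_Archimedean2 by blast
  then have "{t. P n (f t) (g t)} \<inter> {t. \<bar>g t - st N (\<phi> x)\<bar> < 1} = {}"
    unfolding P_def by auto
  with ult_disjointD[OF P[of n] g1] show False by simp
qed

lemma hyper_hom_st_linear:
  assumes \<phi>: "hyper_hom N L M \<phi>"
  shows "\<exists>\<alpha>. \<forall>r. st N (\<phi> (hreal N r)) = \<alpha> * r"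
proof -
  obtain n where n: "\<And>r. \<bar>r\<bar> < 1 / real (Suc n) \<Longrightarrow> \<bar>st N (\<phi> (hreal N r))\<bar> \<le> real (Suc n)"
    using hyper_hom_bounded_near_zero[OF \<phi>] by blast
  have "st N (\<phi> (hreal N (r + s))) = st N (\<phi> (hreal N r)) + st N (\<phi> (hreal N s))" for r s
    using hyper_homD[OF \<phi>] by (simp add: hreal_add nst_hadd)
  then have "st N (\<phi> (hreal N r)) = st N (\<phi> (hreal N 1)) * r" for r
    by (rule additive_bounded_imp_linear[where \<psi> = "\<lambda>r. st N (\<phi> (hreal N r))", OF _ _ n]) auto
  then show ?thesis by blast
qed

end

section \<open>Multiplier rings\<close>

lemma real_ring_simps [simp]:
  "carrier real_ring = UNIV" "x \<otimes>\<^bsub>real_ring\<^esub> y = x * y" "x \<oplus>\<^bsub>real_ring\<^esub> y = x + y"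
  "\<one>\<^bsub>real_ring\<^esub> = 1" "\<zero>\<^bsub>real_ring\<^esub> = 0"
  by (auto simp: real_ring_def)

interpretation real_ring: field real_ring
proof (rule cring.cring_fieldI2)
  show "cring real_ring"
  proof (rule cringI)
    show "abelian_group real_ring"
      by (rule abelian_groupI) (auto intro: exI[of _ "- x" for x])
    show "comm_monoid real_ring"
      by (rule comm_monoidI) auto
  qed (auto simp: distrib_right)
  show "\<exists>y\<in>carrier real_ring. x \<otimes>\<^bsub>real_ring\<^esub> y = \<one>\<^bsub>real_ring\<^esub>"
    if "x \<noteq> \<zero>\<^bsub>real_ring\<^esub>" for x
    using that by (intro bexI[of _ "inverse x"]) auto
qed auto

lemma real_ring_a_inv [simp]: "\<ominus>\<^bsub>real_ring\<^esub> x = - x"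
  by (rule real_ring.minus_equality) auto

lemma real_ring_inv: "x \<noteq> 0 \<Longrightarrow> inv\<^bsub>real_ring\<^esub> x = inverse x"
  by (rule real_ring.comm_inv_char) auto

lemma real_group_inv: "inv\<^bsub>real_group\<^esub> x = - x"
  using real_ring_a_inv unfolding a_inv_def .

lemma real_subgroup_iff:
  "subgroup A real_group \<longleftrightarrow> 0 \<in> A \<and> (\<forall>x\<in>A. \<forall>y\<in>A. x + y \<in> A) \<and> (\<forall>x\<in>A. - x \<in> A)"
proof
  assume A: "subgroup A real_group"
  show "0 \<in> A \<and> (\<forall>x\<in>A. \<forall>y\<in>A. x + y \<in> A) \<and> (\<forall>x\<in>A. - x \<in> A)"
    using subgroup.one_closed[OF A] subgroup.m_closed[OF A]
      subgroup.m_inv_closed[OF A, unfolded real_group_inv]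
    by simp
next
  assume A: "0 \<in> A \<and> (\<forall>x\<in>A. \<forall>y\<in>A. x + y \<in> A) \<and> (\<forall>x\<in>A. - x \<in> A)"
  then show "subgroup A real_group"
    by (intro real_ring.add.subgroupI) (auto simp only: real_group_inv, auto)
qed

lemma int_mult_in_subgroup:
  assumes A: "subgroup A real_group" and x: "x \<in> A"
  shows "of_int m * x \<in> A"
proof -
  have nat: "of_nat n * x \<in> A" for n
    using A x unfolding real_subgroup_iff by (induction n) (auto simp: distrib_right)
  show ?thesis
  proof (cases m)
    case (nonneg n) then show ?thesis using nat by simp
  next
    case (neg n)
    then have "of_int m = - (of_nat (Suc n) :: real)" by simp
    then have "of_int m * x = - (of_nat (Suc n) * x)" by (metis mult_minus_left)
    then show ?thesis using nat[of "Suc n"] A by (simp only: real_subgroup_iff)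
  qed
qed

section \<open>Multiplier rings, quadratic fields and their orders\<close>

definition multipliers :: "real set \<Rightarrow> real set" where
  "multipliers L = {\<alpha>. \<forall>x\<in>L. \<alpha> * x \<in> L}"

lemma multipliers_subring: "subgroup L real_group \<Longrightarrow> subring (multipliers L) real_ring"
  unfolding real_subgroup_iff
  by (intro real_ring.subringI) (auto simp: multipliers_def distrib_right mult.assoc)

text \<open>The other root of the quadratic equation is \<open>t - \<alpha>\<close>, so the second
  factor is the conjugate of the first and the right-hand side is the norm.\<close>

lemma quadratic_norm_form:
  fixes \<alpha> s t p q :: real
  assumes "\<alpha> * \<alpha> = s + t * \<alpha>"
  shows "(p + q * \<alpha>) * (p + q * t - q * \<alpha>) = p * p + p * q * t - q * q * s"
proof -
  have "(p + q * \<alpha>) * (p + q * t - q * \<alpha>) = p * p + p * q * t + q * q * t * \<alpha> - q * q * (\<alpha> * \<alpha>)"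
    by (simp add: algebra_simps)
  then show ?thesis by (simp add: assms algebra_simps)
qed

text \<open>Products reduce by the quadratic equation, and an inverse is the conjugate divided by
  the rational norm.\<close>

lemma quadratic_field:
  fixes \<alpha> :: real
  assumes irr: "\<alpha> \<notin> \<rat>" and sq: "\<alpha> * \<alpha> = s + t * \<alpha>" and st: "s \<in> \<rat>" "t \<in> \<rat>"
  shows "real_quadratic_field {p + q * \<alpha> | p q. p \<in> \<rat> \<and> q \<in> \<rat>}" (is "real_quadratic_field ?K")
proof -
  have KI: "p + q * \<alpha> \<in> ?K" if "p \<in> \<rat>" "q \<in> \<rat>" for p q using that by blast
  have "subring ?K real_ring"
  proof (rule real_ring.subringI)
    show "\<one>\<^bsub>real_ring\<^esub> \<in> ?K" using KI[of 1 0] by simp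
  next
    fix x assume "x \<in> ?K"
    then obtain p q where x: "x = p + q * \<alpha>" "p \<in> \<rat>" "q \<in> \<rat>" by blast
    then show "\<ominus>\<^bsub>real_ring\<^esub> x \<in> ?K" using KI[of "- p" "- q"] by simp
  next
    fix x y assume "x \<in> ?K" "y \<in> ?K"
    then obtain p q p' q' where xy: "x = p + q * \<alpha>" "p \<in> \<rat>" "q \<in> \<rat>" "y = p' + q' * \<alpha>" "p' \<in> \<rat>" "q' \<in> \<rat>"
      by blast
    have "x * y = p * p' + (p * q' + q * p') * \<alpha> + q * q' * (\<alpha> * \<alpha>)"
      by (simp add: xy algebra_simps)
    also have "\<dots> = (p * p' + q * q' * s) + (p * q' + q * p' + q * q' * t) * \<alpha>"
      by (simp add: sq algebra_simps)
    also have "\<dots> \<in> ?K" using xy st by (intro KI) auto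
    finally show "x \<otimes>\<^bsub>real_ring\<^esub> y \<in> ?K" by simp
    show "x \<oplus>\<^bsub>real_ring\<^esub> y \<in> ?K"
      using KI[of "p + p'" "q + q'"] xy by (simp add: algebra_simps)
  qed auto
  moreover have "inv\<^bsub>real_ring\<^esub> x \<in> ?K" if "x \<in> ?K - {\<zero>\<^bsub>real_ring\<^esub>}" for x
  proof -
    from that have "x \<noteq> 0" "x \<in> ?K" by auto
    then obtain p q where x: "x = p + q * \<alpha>" "p \<in> \<rat>" "q \<in> \<rat>" by blast
    define n where "n = p * p + p * q * t - q * q * s"
    have n: "n \<in> \<rat>" unfolding n_def using x st by auto
    have xn: "x * (p + q * t - q * \<alpha>) = n" unfolding x(1) n_def by (rule quadratic_norm_form[OF sq])
    \<comment> \<open>A vanishing conjugate would make \<alpha> rational, or, if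
      \<open>q = 0\<close>, make \<open>x\<close> itself zero. Hence the norm is nonzero.\<close>
    have "p + q * t - q * \<alpha> \<noteq> 0"
    proof
      assume 0: "p + q * t - q * \<alpha> = 0"
      show False
      proof (cases "q = 0")
        case True then show False using 0 x(1) \<open>x \<noteq> 0\<close> by simp
      next
        case False
        then have "\<alpha> = (p + q * t) / q" using 0 by (simp add: field_simps)
        then show False using irr x st by simp
      qed
    qed
    then have "n \<noteq> 0" using xn \<open>x \<noteq> 0\<close> by auto
    then have "inverse x = (p + q * t - q * \<alpha>) / n"
      using xn \<open>x \<noteq> 0\<close> by (simp add: field_simps)
    also have "\<dots> = (p + q * t) / n + (- q / n) * \<alpha>"
      by (simp add: diff_divide_distrib)
    also have "\<dots> \<in> ?K" using n x st by (intro KI) auto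
    finally show ?thesis using \<open>x \<noteq> 0\<close> by (simp add: real_ring_inv)
  qed
  ultimately have "subfield ?K real_ring" by (rule real_ring.subfieldI')
  moreover have "ring.dimension real_ring 2 \<rat> ?K"
  proof -
    \<comment> \<open>The field is built from zero by two line extensions, along 1 and then along
      \<alpha>; each vector lies outside the space before it.\<close>
    have "ring.dimension real_ring 0 \<rat> {0}" using real_ring.zero_dim[of \<rat>] by simp
    moreover have "ring.line_extension real_ring \<rat> 1 {0} = \<rat>"
      by (auto simp: real_ring.line_extension_def set_add_def set_mult_def r_coset_def)
    ultimately have "ring.dimension real_ring 1 \<rat> \<rat>"
      using real_ring.Suc_dim[of 1 "{0}" 0 \<rat>] by simp
    moreover have "ring.line_extension real_ring \<rat> \<alpha> \<rat> = ?K"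
      by (force simp: real_ring.line_extension_def set_add_def set_mult_def r_coset_def add.commute)
    ultimately show ?thesis
      using real_ring.Suc_dim[of \<alpha> \<rat> 1 \<rat>] irr by (simp add: numeral_2_eq_2)
  qed
  ultimately show ?thesis by (simp add: real_quadratic_field_def)
qed

lemma quadratic_order:
  fixes \<alpha> :: real
  assumes A: "subring {of_int m + of_int n * \<alpha> | m n. True} real_ring" (is "subring ?A _")
  shows "order_of_field {p + q * \<alpha> | p q. p \<in> \<rat> \<and> q \<in> \<rat>} ?A"
proof -
  have "?A = generate real_group {1, \<alpha>}"
  proof (rule real_ring.add.generateI)
    show "subgroup ?A real_group" using subring.axioms(1)[OF A] .
    have "of_int 1 + of_int 0 * \<alpha> \<in> ?A" "of_int 0 + of_int 1 * \<alpha> \<in> ?A" by blast+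
    then show "{1, \<alpha>} \<subseteq> ?A" by simp
  next
    fix B assume B: "subgroup B real_group" "{1, \<alpha>} \<subseteq> B"
    have "of_int m + of_int n * \<alpha> \<in> B" for m n
      using int_mult_in_subgroup[OF B(1), of 1 m] int_mult_in_subgroup[OF B(1), of \<alpha> n] B
      unfolding real_subgroup_iff by auto
    then show "?A \<subseteq> B" by blast
  qed
  then have "\<exists>B. finite B \<and> ?A = generate real_group B" by (intro exI[of _ "{1, \<alpha>}"]) simp
  moreover have "\<exists>k::nat. k > 0 \<and> of_nat k * x \<in> ?A" if "p \<in> \<rat>" "q \<in> \<rat>" "x = p + q * \<alpha>" for x p q
  proof -
    obtain a b where p: "p = of_int a / of_int b" "b > 0" using Rats_cases'[OF \<open>p \<in> \<rat>\<close>] by metis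
    obtain c d where q: "q = of_int c / of_int d" "d > 0" using Rats_cases'[OF \<open>q \<in> \<rat>\<close>] by metis
    \<comment> \<open>The product of the two denominators clears both coordinates.\<close>
    have "of_nat (nat (b * d)) * x = of_int (a * d) + of_int (c * b) * \<alpha>"
      using p q that(3) by (simp add: field_simps)
    then have "of_nat (nat (b * d)) * x \<in> ?A" by blast
    then show ?thesis using p q by (intro exI[of _ "nat (b * d)"]) simp
  qed
  moreover have "?A \<subseteq> {p + q * \<alpha> | p q. p \<in> \<rat> \<and> q \<in> \<rat>}" using Rats_of_int by blast
  ultimately show ?thesis unfolding order_of_field_def using A by blast
qed

text \<open>Applying a multiplier to \<open>a\<close> and dividing by \<open>a\<close> writes it as
  an integral combination of 1 and \<theta>. If the coefficient of \<theta> is not always zero, a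
  multiplier whose coefficient is positive and least generates the ring together with 1.\<close>

lemma multipliers_dichotomy:
  assumes L: "pseudolattice L"
  shows "multipliers L = \<int> \<or>
    (\<exists>K. real_quadratic_field K \<and> order_of_field K (multipliers L))"
proof -
  let ?E = "multipliers L"
  obtain a b where ab: "L = {of_int m * a + of_int n * b | m n. True}"
    "\<And>m n. of_int m * a + of_int n * b = 0 \<Longrightarrow> m = 0 \<and> n = 0"
    using L unfolding pseudolattice_def by blast
  have sub: "subring ?E real_ring"
    using L multipliers_subring by (simp add: pseudolattice_def)
  then have grp: "subgroup ?E real_group" by (rule subring.axioms(1))
  have mult: "x * y \<in> ?E" if "x \<in> ?E" "y \<in> ?E" for x y
    using that by (auto simp: multipliers_def mult.assoc)
  have one: "of_int m \<in> ?E" for m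
    using int_mult_in_subgroup[OF grp, of 1 m] by (simp add: multipliers_def)
  have a: "a \<noteq> 0" using ab(2)[of 1 0] by auto
  define \<theta> where "\<theta> = b / a"
  have \<theta>: "\<theta> \<notin> \<rat>"
  proof
    assume "\<theta> \<in> \<rat>"
    then obtain p q where "\<theta> = of_int p / of_int q" "q > 0" using Rats_cases' by metis
    then have "of_int p * a + of_int (- q) * b = 0" using a by (simp add: \<theta>_def field_simps)
    then show False using ab(2) \<open>q > 0\<close> by fastforce
  qed
  have form: "\<exists>m n. \<alpha> = of_int m + of_int n * \<theta>" if "\<alpha> \<in> ?E" for \<alpha>
  proof -
    have "of_int 1 * a + of_int 0 * b \<in> L" unfolding ab(1) by blast
    then have "\<alpha> * a \<in> L" using that by (simp add: multipliers_def)
    then obtain m n where "\<alpha> * a = of_int m * a + of_int n * b" unfolding ab(1) by blast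
    then have "\<alpha> = of_int m + of_int n * \<theta>" using a by (simp add: \<theta>_def field_simps)
    then show ?thesis by blast
  qed
  show ?thesis
  proof (cases "\<exists>m n. n \<noteq> 0 \<and> of_int m + of_int n * \<theta> \<in> ?E")
    case False
    have "x \<in> \<int>" if x: "x \<in> ?E" for x
    proof -
      obtain m n where mn: "x = of_int m + of_int n * \<theta>" using form[OF x] by blast
      then have "n = 0" using False x by blast
      then show ?thesis by (simp add: mn)
    qed
    moreover have "\<int> \<subseteq> ?E" unfolding Ints_def using one by blast
    ultimately show ?thesis by blast
  next
    case True
    define P where "P = (\<lambda>k::nat. k > 0 \<and> (\<exists>m. of_int m + of_nat k * \<theta> \<in> ?E))"
    obtain m n where mn: "n \<noteq> 0" "of_int m + of_int n * \<theta> \<in> ?E" using True by blast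
    \<comment> \<open>Negation is used to make the coefficient of \<theta> positive.\<close>
    have "of_int (- m) + of_int (- n) * \<theta> \<in> ?E"
      using mn(2) grp unfolding real_subgroup_iff by force
    then have "P (nat \<bar>n\<bar>)"
      using mn unfolding P_def by (cases "n > 0") (auto intro: exI[of _ m] exI[of _ "- m"])
    define k where "k = Least P"
    have "P k" unfolding k_def using \<open>P (nat \<bar>n\<bar>)\<close> by (rule LeastI)
    then obtain m0 where k: "k > 0" and m0: "of_int m0 + of_nat k * \<theta> \<in> ?E"
      by (auto simp: P_def)
    have least: "\<not> P j" if "j < k" for j using that not_less_Least unfolding k_def by blast
    define \<alpha> where "\<alpha> = of_int m0 + of_nat k * \<theta>"
    have E: "?E = {of_int m + of_int n * \<alpha> | m n. True}"
    proof (intro equalityI subsetI)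
      fix x assume x: "x \<in> ?E"
      then obtain m n where mn: "x = of_int m + of_int n * \<theta>" using form by blast
      \<comment> \<open>Subtracting \<open>q\<close> times \<alpha> leaves a multiplier whose
        coefficient is the remainder modulo \<open>k\<close>; minimality of \<open>k\<close> forces
        it to be 0.\<close>
      define q where "q = n div int k"
      have n: "n = q * int k + n mod int k" by (simp add: q_def)
      then have "real_of_int n = of_int q * of_nat k + of_int (n mod int k)"
        by (metis of_int_add of_int_mult of_int_of_nat_eq)
      then have eq: "x + - (of_int q * \<alpha>) = of_int (m - q * m0) + of_int (n mod int k) * \<theta>"
        by (simp add: mn \<alpha>_def algebra_simps)
      have "x + - (of_int q * \<alpha>) \<in> ?E"
        using int_mult_in_subgroup[OF grp m0, of q] x grp unfolding \<alpha>_def real_subgroup_iff by blast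
      then have "of_int (m - q * m0) + of_int (n mod int k) * \<theta> \<in> ?E" unfolding eq .
      moreover have "0 \<le> n mod int k" "n mod int k < int k" using k by auto
      ultimately have "n mod int k = 0"
        using least[of "nat (n mod int k)"] unfolding P_def
        by (metis nat_0_le nat_less_iff of_int_of_nat_eq order_le_less zero_less_nat_eq)
      then have "x = of_int (m - q * m0) + of_int q * \<alpha>" using eq by simp
      then show "x \<in> {of_int m + of_int n * \<alpha> | m n. True}" by blast
    next
      fix x assume "x \<in> {of_int m + of_int n * \<alpha> | m n. True}"
      then show "x \<in> ?E"
        using one int_mult_in_subgroup[OF grp m0] grp unfolding \<alpha>_def real_subgroup_iff by blast
    qed
    have "\<alpha> \<notin> \<rat>"
    proof
      assume "\<alpha> \<in> \<rat>"
      moreover have "\<theta> = (\<alpha> - of_int m0) / of_nat k" using k by (simp add: \<alpha>_def)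
      ultimately show False using \<theta> by simp
    qed
    moreover have "\<alpha> * \<alpha> \<in> ?E" using m0 mult by (simp add: \<alpha>_def)
    then obtain s t where "\<alpha> * \<alpha> = of_int s + of_int t * \<alpha>" unfolding E by blast
    ultimately have "real_quadratic_field {p + q * \<alpha> | p q. p \<in> \<rat> \<and> q \<in> \<rat>}"
      by (intro quadratic_field[of \<alpha> "of_int s" "of_int t"]) auto
    moreover have "order_of_field {p + q * \<alpha> | p q. p \<in> \<rat> \<and> q \<in> \<rat>} ?E"
      using quadratic_order[of \<alpha>] sub unfolding E by blast
    ultimately show ?thesis by blast
  qed
qed

section \<open>Morphisms of Quantum Tori\<close>

definition real_coset :: "real set \<Rightarrow> real \<Rightarrow> real set" where
  "real_coset L r = {l + r | l. l \<in> L}"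

lemma r_coset_real_group: "L #>\<^bsub>real_group\<^esub> r = real_coset L r"
  by (auto simp: r_coset_def real_coset_def)

lemma carrier_quantum_torus: "carrier (quantum_torus L) = range (real_coset L)"
  unfolding quantum_torus_def FactGroup_def RCOSETS_def r_coset_real_group by auto

lemma real_coset_eq_iff:
  assumes "subgroup L real_group"
  shows "real_coset L r = real_coset L s \<longleftrightarrow> r - s \<in> L"
proof
  have L: "0 \<in> L" "x \<in> L \<Longrightarrow> y \<in> L \<Longrightarrow> x + y \<in> L" "x \<in> L \<Longrightarrow> - x \<in> L" for x y
    using assms unfolding real_subgroup_iff by blast+
  assume "real_coset L r = real_coset L s"
  moreover have "0 + r \<in> real_coset L r" using L(1) unfolding real_coset_def by blast
  ultimately show "r - s \<in> L" by (auto simp: real_coset_def)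
next
  have L: "x \<in> L \<Longrightarrow> y \<in> L \<Longrightarrow> x + y \<in> L" "x \<in> L \<Longrightarrow> - x \<in> L" for x y
    using assms unfolding real_subgroup_iff by blast+
  have sub: "real_coset L r \<subseteq> real_coset L s" if "r - s \<in> L" for r s
  proof
    fix x assume "x \<in> real_coset L r"
    then obtain l where "l \<in> L" "x = l + r" by (auto simp: real_coset_def)
    then have "x = (l + (r - s)) + s" "l + (r - s) \<in> L" using L(1) that by auto
    then show "x \<in> real_coset L s" unfolding real_coset_def by blast
  qed
  assume "r - s \<in> L"
  moreover from L(2)[OF this] have "s - r \<in> L" by simp
  ultimately show "real_coset L r = real_coset L s" using sub by blast
qed

lemma real_coset_zero: "real_coset L 0 = L"
  by (simp add: real_coset_def)

lemma quantum_torus_mult: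
  assumes "subgroup L real_group"
  shows "real_coset L r \<otimes>\<^bsub>quantum_torus L\<^esub> real_coset L s = real_coset L (r + s)"
proof -
  have L: "0 \<in> L" "x \<in> L \<Longrightarrow> y \<in> L \<Longrightarrow> x + y \<in> L" for x y
    using assms unfolding real_subgroup_iff by blast+
  have "x \<in> real_coset L (r + s) \<longleftrightarrow> (\<exists>l\<in>L. \<exists>l'\<in>L. x = (l + r) + (l' + s))" for x
  proof
    assume "x \<in> real_coset L (r + s)"
    then obtain l where "l \<in> L" "x = (l + r) + (0 + s)" by (auto simp: real_coset_def)
    then show "\<exists>l\<in>L. \<exists>l'\<in>L. x = (l + r) + (l' + s)" using L(1) by blast
  next
    assume "\<exists>l\<in>L. \<exists>l'\<in>L. x = (l + r) + (l' + s)"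
    then obtain l l' where "l \<in> L" "l' \<in> L" "x = (l + l') + (r + s)" by auto
    then show "x \<in> real_coset L (r + s)" using L(2) unfolding real_coset_def by blast
  qed
  then show ?thesis
    by (auto simp: quantum_torus_def FactGroup_def set_mult_def) (auto simp: real_coset_def)
qed

text \<open>The union runs over all representatives instead of choosing one; for a multiplier its
  members coincide. The restriction to the carrier gives the extensional form used for
  morphisms.\<close>

definition torus_scale :: "real set \<Rightarrow> real \<Rightarrow> real set \<Rightarrow> real set" where
  "torus_scale L \<alpha> = (\<lambda>X\<in>carrier (quantum_torus L). \<Union>r\<in>X. real_coset L (\<alpha> * r))"

lemma torus_scale_coset:
  assumes L: "subgroup L real_group" and \<alpha>: "\<alpha> \<in> multipliers L"
  shows "torus_scale L \<alpha> (real_coset L r) = real_coset L (\<alpha> * r)"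
proof -
  have "real_coset L (\<alpha> * (l + r)) = real_coset L (\<alpha> * r)" if "l \<in> L" for l
    using \<alpha> that by (simp add: real_coset_eq_iff[OF L] multipliers_def distrib_left)
  moreover have "0 \<in> L" using L unfolding real_subgroup_iff by blast
  ultimately have "(\<Union>s\<in>real_coset L r. real_coset L (\<alpha> * s)) = real_coset L (\<alpha> * r)"
    unfolding real_coset_def[of L r] by blast
  then show ?thesis by (simp add: torus_scale_def carrier_quantum_torus)
qed

lemma torus_map_eqI:
  assumes "f \<in> extensional (carrier (quantum_torus L))" "g \<in> extensional (carrier (quantum_torus L))"
    and "\<And>r. f (real_coset L r) = g (real_coset L r)"
  shows "f = g"
  using assms by (intro extensionalityI[of f "carrier (quantum_torus L)" g]) (auto simp: carrier_quantum_torus)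

context ns_model
begin

section \<open>Morphisms of Hyper Quantum Tori and the scaling maps they induce\<close>

lemma hproj_eq: "hproj N L x = {hreal N l \<oplus>\<^sub>H x | l. l \<in> L}"
  by (auto simp: hproj_def r_coset_def nst_group_def hyper_group_def)

lemma carrier_hyper_torus: "carrier (hyper_torus N L) = hproj N L ` nst N"
  by (auto simp: hyper_torus_def FactGroup_def RCOSETS_def hproj_def nst_group_def)

lemma torus_st_hproj:
  assumes L: "subgroup L real_group" and x: "x \<in> nst N"
  shows "torus_st N L (hproj N L x) = real_coset L (st N x)"
proof -
  have "real_coset L (st N (hreal N l \<oplus>\<^sub>H x)) = real_coset L (st N x)" if "l \<in> L" for l
    using that x by (simp add: nst_hadd real_coset_eq_iff[OF L])
  moreover have "0 \<in> L" using L unfolding real_subgroup_iff by blast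
  ultimately show ?thesis unfolding torus_st_def hproj_eq r_coset_real_group by blast
qed

lemma hproj_shift:
  assumes L: "subgroup L real_group" and l: "l \<in> L" and x: "x \<in> H"
  shows "hproj N L (hreal N l \<oplus>\<^sub>H x) = hproj N L x"
proof -
  have shift: "hreal N k \<oplus>\<^sub>H (hreal N l \<oplus>\<^sub>H x) = hreal N (k + l) \<oplus>\<^sub>H x" for k
    using x by (simp add: hreal_add hadd_assoc)
  have sub: "k + l \<in> L" "k + - l \<in> L" if "k \<in> L" for k
    using L l that unfolding real_subgroup_iff by blast+
  show ?thesis
  proof (intro equalityI subsetI)
    fix y assume "y \<in> hproj N L (hreal N l \<oplus>\<^sub>H x)"
    then show "y \<in> hproj N L x" unfolding hproj_eq shift using sub(1) by blast
  next
    fix y assume "y \<in> hproj N L x"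
    then obtain k where k: "k \<in> L" "y = hreal N k \<oplus>\<^sub>H x" unfolding hproj_eq by blast
    then have "y = hreal N (k + - l) \<oplus>\<^sub>H (hreal N l \<oplus>\<^sub>H x)" by (simp add: shift)
    then show "y \<in> hproj N L (hreal N l \<oplus>\<^sub>H x)" unfolding hproj_eq using sub(2) k(1) by blast
  qed
qed

lemma mem_hproj: "subgroup L real_group \<Longrightarrow> x \<in> H \<Longrightarrow> x \<in> hproj N L x"
  unfolding hproj_eq real_subgroup_iff using hadd_zero[of x] by (auto intro!: exI[of _ 0])

text \<open>Each coset of a real \<open>r\<close> is the image of the class of
  \<open>hreal N r\<close>, so \<open>f\<close> is already determined by the standard parts of
  \<phi> at standard reals, which are linear in \<open>r\<close>.\<close>

lemma quantum_torus_mor_imp_scale: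
  assumes L: "subgroup L real_group" and f: "f \<in> quantum_torus_mor N L L"
  obtains \<alpha> where "\<alpha> \<in> multipliers L" "f = torus_scale L \<alpha>"
proof -
  obtain F where F: "F \<in> hyper_torus_mor N L L"
      "\<And>X. X \<in> carrier (hyper_torus N L) \<Longrightarrow> torus_st N L (F X) = f (torus_st N L X)"
    using f unfolding quantum_torus_mor_def by blast
  obtain \<phi> where \<phi>: "hyper_hom N L L \<phi>" "\<And>x. x \<in> nst N \<Longrightarrow> F (hproj N L x) = hproj N L (\<phi> x)"
    using F(1) unfolding hyper_torus_mor_def by blast
  obtain \<alpha> where \<alpha>: "\<And>r. st N (\<phi> (hreal N r)) = \<alpha> * r"
    using hyper_hom_st_linear[OF \<phi>(1)] by blast
  have f_coset: "f (real_coset L r) = real_coset L (\<alpha> * r)" for r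
  proof -
    have "torus_st N L (F (hproj N L (hreal N r))) = f (torus_st N L (hproj N L (hreal N r)))"
      by (intro F) (simp add: carrier_hyper_torus)
    then show ?thesis
      using \<phi>(2)[of "hreal N r"] hyper_homD(3)[OF \<phi>(1), of "hreal N r"] by (simp add: torus_st_hproj[OF L] \<alpha>)
  qed
  have "\<alpha> * l \<in> L" if "l \<in> L" for l
  proof -
    \<comment> \<open>Both \<open>l\<close> and 0 represent the neutral coset, so \<open>f\<close>
      must send them to the same coset; this is what makes \<alpha> a multiplier.\<close>
    have "real_coset L l = real_coset L 0" using that by (simp add: real_coset_eq_iff[OF L])
    then have "real_coset L (\<alpha> * l) = real_coset L (\<alpha> * 0)" using f_coset by metis
    then show ?thesis by (simp add: real_coset_eq_iff[OF L])
  qed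
  then have mem: "\<alpha> \<in> multipliers L" by (simp add: multipliers_def)
  moreover have "f = torus_scale L \<alpha>"
  proof (rule torus_map_eqI)
    show "f \<in> extensional (carrier (quantum_torus L))"
      using f unfolding quantum_torus_mor_def by (simp add: PiE_iff)
    show "torus_scale L \<alpha> \<in> extensional (carrier (quantum_torus L))" by (simp add: torus_scale_def)
  qed (simp add: f_coset torus_scale_coset[OF L mem])
  ultimately show ?thesis by (rule that)
qed

text \<open>The lift is the star of multiplication by \<alpha>: its graph is the star of a real
  graph, and it multiplies standard parts by \<alpha>.\<close>

lemma torus_scale_mor:
  assumes L: "subgroup L real_group" and \<alpha>: "\<alpha> \<in> multipliers L"
  shows "torus_scale L \<alpha> \<in> quantum_torus_mor N L L"
proof -
  define \<phi> where "\<phi> = val N ((*) \<alpha>)"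
  define F where "F = (\<lambda>X\<in>carrier (hyper_torus N L). \<Union>x\<in>X. hproj N L (\<phi> x))"
  \<comment> \<open>A shift by a standard \<open>l\<close> in \<open>L\<close> becomes a shift by
    the standard real \<open>\<alpha> * l\<close>, which is again in \<open>L\<close>.\<close>
  have \<phi>_shift: "hproj N L (\<phi> (hreal N l \<oplus>\<^sub>H x)) = hproj N L (\<phi> x)" if "l \<in> L" "x \<in> H" for l x
    using that \<alpha> hproj_shift[OF L, of "\<alpha> * l" "val N ((*) \<alpha>) x"]
    by (simp add: \<phi>_def val_scale_hadd val_hreal multipliers_def)
  have hom: "hyper_hom N L L \<phi>"
    unfolding hyper_hom_def
  proof (intro conjI ballI)
    show "\<phi> \<in> hom (hyper_group N) (hyper_group N)"
      by (auto simp: hom_def hyper_group_def \<phi>_def val_scale_hadd)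
    show "internal N (mkset (nonstd N) {opair (nonstd N) x (\<phi> x) | x. x \<in> H})"
      unfolding \<phi>_def graph_eq_star by (rule internal_star)
    show "\<phi> ` nst N \<subseteq> nst N" by (auto simp: \<phi>_def nst_scale)
    show "hproj N L (\<phi> s) = hproj N L (\<phi> r)" if "r \<in> nst N" "s \<in> hproj N L r" for r s
      using that \<phi>_shift nst_st(1) unfolding hproj_eq[of L r] by blast
  qed
  have F: "F (hproj N L x) = hproj N L (\<phi> x)" if x: "x \<in> nst N" for x
  proof -
    have "hproj N L (\<phi> y) = hproj N L (\<phi> x)" if "y \<in> hproj N L x" for y
      using that x hom unfolding hyper_hom_def by blast
    then have "(\<Union>y\<in>hproj N L x. hproj N L (\<phi> y)) = hproj N L (\<phi> x)"
      using mem_hproj[OF L nst_st(1)[OF x]] by blast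
    then show ?thesis using x by (simp add: F_def carrier_hyper_torus)
  qed
  have "F \<in> carrier (hyper_torus N L) \<rightarrow>\<^sub>E carrier (hyper_torus N L)"
  proof (rule PiE_I)
    show "F X \<in> carrier (hyper_torus N L)" if "X \<in> carrier (hyper_torus N L)" for X
      using that F by (auto simp: carrier_hyper_torus \<phi>_def nst_scale)
  qed (simp add: F_def)
  then have "F \<in> hyper_torus_mor N L L"
    unfolding hyper_torus_mor_def using hom F by blast
  moreover have "torus_st N L (F X) = torus_scale L \<alpha> (torus_st N L X)"
    if "X \<in> carrier (hyper_torus N L)" for X
    using that by (auto simp: carrier_hyper_torus F torus_st_hproj[OF L] torus_scale_coset[OF L \<alpha>]
        \<phi>_def nst_scale)
  moreover have "torus_scale L \<alpha> \<in> carrier (quantum_torus L) \<rightarrow>\<^sub>E carrier (quantum_torus L)"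
    by (rule PiE_I) (auto simp: carrier_quantum_torus torus_scale_coset[OF L \<alpha>], auto simp: torus_scale_def carrier_quantum_torus)
  ultimately show ?thesis unfolding quantum_torus_mor_def by blast
qed

text \<open>Surjectivity is \<open>quantum_torus_mor_imp_scale\<close>. Injectivity rests on
  \<open>proper\<close>: two distinct multipliers with the same scaling map would force every real
  into \<open>L\<close>.\<close>

lemma torus_scale_ring_iso:
  assumes L: "subgroup L real_group" and proper: "L \<noteq> UNIV"
  shows "torus_scale L \<in> ring_iso (real_ring\<lparr>carrier := multipliers L\<rparr>) (quantum_torus_End N L)"
proof -
  let ?C = "carrier (quantum_torus L)"
  note sub = multipliers_subring[OF L]
  have ext: "torus_scale L \<alpha> \<in> extensional ?C" for \<alpha> by (simp add: torus_scale_def)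
  have coset: "real_coset L r \<in> ?C" for r by (simp add: carrier_quantum_torus)
  note scale = torus_scale_coset[OF L]
  show ?thesis
  proof (rule ring_iso_memI)
    show "torus_scale L x \<in> carrier (quantum_torus_End N L)"
      if "x \<in> carrier (real_ring\<lparr>carrier := multipliers L\<rparr>)" for x
      using that torus_scale_mor[OF L] by (simp add: quantum_torus_End_def)
  next
    fix x y
    assume xy: "x \<in> carrier (real_ring\<lparr>carrier := multipliers L\<rparr>)"
      "y \<in> carrier (real_ring\<lparr>carrier := multipliers L\<rparr>)"
    then have m: "x * y \<in> multipliers L" and a: "x + y \<in> multipliers L"
      using subringE(6,7)[OF sub] by auto
    have "torus_scale L (x * y) = compose ?C (torus_scale L x) (torus_scale L y)"
      using xy by (intro torus_map_eqI[of _ L]) (auto simp: ext scale m compose_def coset mult.assoc)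
    then show "torus_scale L (x \<otimes>\<^bsub>real_ring\<lparr>carrier := multipliers L\<rparr>\<^esub> y) =
        torus_scale L x \<otimes>\<^bsub>quantum_torus_End N L\<^esub> torus_scale L y"
      by (simp add: quantum_torus_End_def)
    have "torus_scale L (x + y) = (\<lambda>X\<in>?C. torus_scale L x X \<otimes>\<^bsub>quantum_torus L\<^esub> torus_scale L y X)"
      using xy by (intro torus_map_eqI[of _ L])
        (auto simp: ext scale a coset quantum_torus_mult[OF L] distrib_right)
    then show "torus_scale L (x \<oplus>\<^bsub>real_ring\<lparr>carrier := multipliers L\<rparr>\<^esub> y) =
        torus_scale L x \<oplus>\<^bsub>quantum_torus_End N L\<^esub> torus_scale L y"
      by (simp add: quantum_torus_End_def)
  next
    have "1 \<in> multipliers L" by (simp add: multipliers_def)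
    then have "torus_scale L 1 = (\<lambda>X\<in>?C. X)"
      by (intro torus_map_eqI[of _ L]) (auto simp: ext scale coset)
    then show "torus_scale L \<one>\<^bsub>real_ring\<lparr>carrier := multipliers L\<rparr>\<^esub> = \<one>\<^bsub>quantum_torus_End N L\<^esub>"
      by (simp add: quantum_torus_End_def)
  next
    have "x = y" if xy: "x \<in> multipliers L" "y \<in> multipliers L" "torus_scale L x = torus_scale L y" for x y
    proof (rule ccontr)
      assume "x \<noteq> y"
      have "r \<in> L" for r
      proof -
        \<comment> \<open>The point \<open>r / (x - y)\<close> is chosen so that its two images
          differ by exactly \<open>r\<close>.\<close>
        have "real_coset L (x * (r / (x - y))) = real_coset L (y * (r / (x - y)))"
          using scale[OF xy(1)] scale[OF xy(2)] xy(3) by metis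
        then have "x * (r / (x - y)) - y * (r / (x - y)) \<in> L" by (simp only: real_coset_eq_iff[OF L])
        also have "x * (r / (x - y)) - y * (r / (x - y)) = r"
          unfolding left_diff_distrib[symmetric] using \<open>x \<noteq> y\<close> by simp
        finally show "r \<in> L" .
      qed
      then show False using proper by blast
    qed
    then have "bij_betw (torus_scale L) (multipliers L) (quantum_torus_mor N L L)"
      using torus_scale_mor[OF L] quantum_torus_mor_imp_scale[OF L]
      unfolding bij_betw_def inj_on_def by blast
    then show "bij_betw (torus_scale L) (carrier (real_ring\<lparr>carrier := multipliers L\<rparr>))
        (carrier (quantum_torus_End N L))"
      by (simp add: quantum_torus_End_def)
  qed
qed

text \<open>\<open>ring_iso_imp_img_ring\<close> yields a ring whose zero is the image of 0; this
  identifies that image with the zero of \<open>quantum_torus_End\<close>.\<close>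

lemma torus_scale_zero:
  assumes "subgroup L real_group"
  shows "torus_scale L 0 = \<zero>\<^bsub>quantum_torus_End N L\<^esub>"
proof -
  have "0 \<in> multipliers L" "\<one>\<^bsub>quantum_torus L\<^esub> = real_coset L 0"
    using assms unfolding real_subgroup_iff
    by (auto simp: multipliers_def quantum_torus_def FactGroup_def real_coset_zero)
  then show ?thesis
    unfolding quantum_torus_End_def
    by (intro torus_map_eqI[of _ L])
      (auto simp: torus_scale_coset[OF assms] carrier_quantum_torus, auto simp: torus_scale_def carrier_quantum_torus)
qed

end

text \<open>A free group of rank two is not divisible: if \<open>a / 2\<close> were in
  \<open>L\<close>, independence of \<open>a\<close> and \<open>b\<close> would make the odd number
  \<open>2 * m - 1\<close> vanish.\<close>

lemma pseudolattice_proper: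
  assumes "pseudolattice L"
  shows "L \<noteq> UNIV"
proof
  assume U: "L = UNIV"
  obtain a b where ab: "L = {of_int m * a + of_int n * b | m n. True}"
    "\<And>m n. of_int m * a + of_int n * b = 0 \<Longrightarrow> m = 0 \<and> n = 0"
    using assms unfolding pseudolattice_def by blast
  obtain m n where "a / 2 = of_int m * a + of_int n * b" using U ab(1) by blast
  then have "of_int (2 * m - 1) * a + of_int (2 * n) * b = 0" by (simp add: algebra_simps)
  from ab(2)[OF this] show False by presburger
qed

lemma int_ring_iso_Ints: "\<Z> \<simeq> real_ring\<lparr>carrier := \<int>\<rparr>"
proof -
  have "of_int \<in> ring_iso \<Z> (real_ring\<lparr>carrier := \<int>\<rparr>)"
    by (rule ring_iso_memI) (auto simp: bij_betw_def inj_on_def Ints_def)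
  then show ?thesis by (auto simp: is_ring_iso_def)
qed

theorem theoremB:
  fixes N :: "('v, 'w) nsmodel" and L :: "real set"
  assumes "nonstandard_model N" and "pseudolattice L"
  shows "ring (quantum_torus_End N L) \<and>
    (quantum_torus_End N L \<simeq> \<Z> \<or>
     (\<exists>K A. real_quadratic_field K \<and> order_of_field K A \<and>
        quantum_torus_End N L \<simeq> real_ring\<lparr>carrier := A\<rparr>))"
proof -
  interpret ns_model N by unfold_locales fact
  let ?E = "real_ring\<lparr>carrier := multipliers L\<rparr>"
  have L: "subgroup L real_group" using assms(2) by (simp add: pseudolattice_def)
  have E: "ring ?E" using real_ring.subring_is_ring[OF multipliers_subring[OF L]] .
  note iso = torus_scale_ring_iso[OF L pseudolattice_proper[OF assms(2)]]
  have "ring (quantum_torus_End N L)"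
    using ring.ring_iso_imp_img_ring[OF E iso] torus_scale_zero[OF L] by simp
  moreover have End: "quantum_torus_End N L \<simeq> ?E"
    using ring_iso_sym[OF E] iso unfolding is_ring_iso_def by blast
  moreover have "quantum_torus_End N L \<simeq> \<Z>" if "multipliers L = \<int>"
    using ring_iso_trans[OF End[unfolded that] ring_iso_sym[OF _ int_ring_iso_Ints]]
      int_is_cring cring.axioms(1) by blast
  ultimately show ?thesis using multipliers_dichotomy[OF assms(2)] by blast
qed

end
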